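(* Let $G$ be a locally compact group. For every $c\geq 1$, $B_c(G)$ carries a unique invariant mean. This mean is also inversion invariant.
   Context: For $c\ge 1$, $B_c(G)$ is the space of functions $\varphi:G\to\mathbb{C}$ of the form $\varphi(s)=\langle\pi(s)\xi,\eta\rangle$, where $\pi$ is a strongly continuous homomorphism from $G$ to the invertible bounded operators on a Hilbert space $\mathcal{H}_\pi$ with $\sup_{s\in G}\|\pi(s)\|\le c$, and $\xi,\eta\in\mathcal{H}_\pi$. It is a space of bounded continuous functions that contains the constants and is closed under complex conjugation, left and right translations, and inversion $\check\varphi(s)=\varphi(s^{-1})$. A mean on $B_c(G)$ is a positive linear functional $m:B_c(G)\to\mathbb{C}$ with $m(1)=1$ (positive: $m(\varphi)\ge0$ whenever $\varphi\ge0$ pointwise). It is invariant if $m(s\cdot\varphi)=m(\varphi)$ for all $s\in G$ and $\varphi\in B_c(G)$, where $s\cdot\varphi(t)=\varphi(s^{-1}t)$. It is inversion invariant if $m(\check\varphi)=m(\varphi)$ for all $\varphi\in B_c(G)$. *)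

theory Defs
  imports "HOL-Analysis.Analysis" "HOL-Algebra.Module" "HOL-Library.Nonpos_Ints"
begin

section \<open>Complex Hilbert spaces with an explicit carrier\<close>

text \<open>
  The Hilbert space of a representation is existentially quantified inside the definition of
  \<open>B\<^sub>c(G)\<close>, so it has to be a value rather than a type.  It is a module over the ring of complex
  numbers, extended by a sesquilinear form.  The fields \<^const>\<open>mult\<close> and \<^const>\<open>one\<close>, which the
  record type of modules inherits from rings, are not used.
\<close>

definition complex_ring :: "complex ring" where
  "complex_ring = \<lparr>carrier = UNIV, mult = (*), one = 1, zero = 0, add = (+)\<rparr>"

record 'h inner_module = "(complex, 'h) module" +
  cinner :: "'h \<Rightarrow> 'h \<Rightarrow> complex"

locale complex_inner_space = Module.module complex_ring H for H :: "'h inner_module" +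
  assumes cinner_add_left: "\<lbrakk>x \<in> carrier H; y \<in> carrier H; z \<in> carrier H\<rbrakk> \<Longrightarrow>
      cinner H (x \<oplus>\<^bsub>H\<^esub> y) z = cinner H x z + cinner H y z"
    and cinner_smult_left: "\<lbrakk>x \<in> carrier H; y \<in> carrier H\<rbrakk> \<Longrightarrow>
      cinner H (a \<odot>\<^bsub>H\<^esub> x) y = a * cinner H x y"
    and cinner_commute: "\<lbrakk>x \<in> carrier H; y \<in> carrier H\<rbrakk> \<Longrightarrow> cinner H x y = cnj (cinner H y x)"
    and cinner_nonneg: "x \<in> carrier H \<Longrightarrow> cinner H x x \<in> \<real>\<^sub>\<ge>\<^sub>0"
    and cinner_definite: "\<lbrakk>x \<in> carrier H; cinner H x x = 0\<rbrakk> \<Longrightarrow> x = \<zero>\<^bsub>H\<^esub>"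

definition hnorm :: "'h inner_module \<Rightarrow> 'h \<Rightarrow> real" where
  "hnorm H x = sqrt (Re (cinner H x x))"

text \<open>
  The value off the carrier is irrelevant; it is fixed because \<^locale>\<open>Metric_space\<close> requires a
  distance that is symmetric and nonnegative on the whole type.
\<close>

definition hdist :: "'h inner_module \<Rightarrow> 'h \<Rightarrow> 'h \<Rightarrow> real" where
  "hdist H x y = (if x \<in> carrier H \<and> y \<in> carrier H then hnorm H (x \<ominus>\<^bsub>H\<^esub> y) else 0)"

locale complex_hilbert_space = complex_inner_space H for H :: "'h inner_module" +
  assumes complete: "Metric_space.mcomplete (carrier H) (hdist H)"

abbreviation htopology :: "'h inner_module \<Rightarrow> 'h topology" where
  "htopology H \<equiv> Metric_space.mtopology (carrier H) (hdist H)"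

definition bounded_operator :: "'h inner_module \<Rightarrow> ('h \<Rightarrow> 'h) \<Rightarrow> bool" where
  "bounded_operator H T \<longleftrightarrow>
     T \<in> carrier H \<rightarrow> carrier H \<and>
     (\<forall>x\<in>carrier H. \<forall>y\<in>carrier H. T (x \<oplus>\<^bsub>H\<^esub> y) = T x \<oplus>\<^bsub>H\<^esub> T y) \<and>
     (\<forall>a. \<forall>x\<in>carrier H. T (a \<odot>\<^bsub>H\<^esub> x) = a \<odot>\<^bsub>H\<^esub> T x) \<and>
     (\<exists>K. \<forall>x\<in>carrier H. hnorm H (T x) \<le> K * hnorm H x)"

definition invertible_operator :: "'h inner_module \<Rightarrow> ('h \<Rightarrow> 'h) \<Rightarrow> bool" where
  "invertible_operator H T \<longleftrightarrow>
     bounded_operator H T \<and>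
     (\<exists>S. bounded_operator H S \<and> (\<forall>x\<in>carrier H. S (T x) = x \<and> T (S x) = x))"

text \<open>The analogue of \<^const>\<open>onorm\<close>, for bounded operators only.\<close>

definition op_norm :: "'h inner_module \<Rightarrow> ('h \<Rightarrow> 'h) \<Rightarrow> real" where
  "op_norm H T = (SUP x\<in>carrier H. hnorm H (T x) / hnorm H x)"


section \<open>Uniformly bounded representations and their coefficients\<close>

text \<open>
  The group is a type of class \<^class>\<open>topological_group_add\<close>, which is written additively but is
  not assumed to be commutative: \<open>s + t\<close> is the product, \<open>- s\<close> the inverse, \<open>0\<close> the identity.
\<close>

definition bounded_representation ::
    "real \<Rightarrow> 'h inner_module \<Rightarrow> ('g::topological_group_add \<Rightarrow> 'h \<Rightarrow> 'h) \<Rightarrow> bool" where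
  "bounded_representation c H \<pi> \<longleftrightarrow>
     (\<forall>s. invertible_operator H (\<pi> s)) \<and>
     (\<forall>s t. \<forall>x\<in>carrier H. \<pi> (s + t) x = \<pi> s (\<pi> t x)) \<and>
     (\<forall>x\<in>carrier H. continuous_map euclidean (htopology H) (\<lambda>s. \<pi> s x)) \<and>
     (\<forall>s. op_norm H (\<pi> s) \<le> c)"

text \<open>
  The space \<open>B\<^sub>c(G)\<close>.  A definition cannot quantify over types, so the carriers of the Hilbert spaces
  below are subsets of one type, built from the group.  This is no restriction: the theorem
  \<open>coefficient_in_B_space\<close> at the end of this theory shows that the coefficients of
  representations on Hilbert spaces with carriers in an arbitrary type are in this set.
\<close>

definition B_space :: "real \<Rightarrow> ('g::topological_group_add \<Rightarrow> complex) set" where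
  "B_space c = {\<phi>. \<exists>(H :: ('g \<Rightarrow> complex \<times> complex) inner_module) \<pi> \<xi> \<eta>.
     complex_hilbert_space H \<and> bounded_representation c H \<pi> \<and>
     \<xi> \<in> carrier H \<and> \<eta> \<in> carrier H \<and> \<phi> = (\<lambda>s. cinner H (\<pi> s \<xi>) \<eta>)}"


section \<open>Means\<close>

text \<open>
  Functionals on \<open>B\<^sub>c(G)\<close> are functions on all of \<open>'g \<Rightarrow> complex\<close>, of which only the values on
  \<open>B_space c\<close> matter.
\<close>

definition is_mean ::
    "real \<Rightarrow> (('g::topological_group_add \<Rightarrow> complex) \<Rightarrow> complex) \<Rightarrow> bool" where
  "is_mean c m \<longleftrightarrow>
     (\<forall>\<phi>\<in>B_space c. \<forall>\<psi>\<in>B_space c. m (\<lambda>s. \<phi> s + \<psi> s) = m \<phi> + m \<psi>) \<and>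
     (\<forall>a. \<forall>\<phi>\<in>B_space c. m (\<lambda>s. a * \<phi> s) = a * m \<phi>) \<and>
     (\<forall>\<phi>\<in>B_space c. (\<forall>s. \<phi> s \<in> \<real>\<^sub>\<ge>\<^sub>0) \<longrightarrow> m \<phi> \<in> \<real>\<^sub>\<ge>\<^sub>0) \<and>
     m (\<lambda>s. 1) = 1"

definition invariant_mean ::
    "real \<Rightarrow> (('g::topological_group_add \<Rightarrow> complex) \<Rightarrow> complex) \<Rightarrow> bool" where
  "invariant_mean c m \<longleftrightarrow>
     is_mean c m \<and> (\<forall>s. \<forall>\<phi>\<in>B_space c. m (\<lambda>t. \<phi> (- s + t)) = m \<phi>)"

definition inversion_invariant ::
    "real \<Rightarrow> (('g::topological_group_add \<Rightarrow> complex) \<Rightarrow> complex) \<Rightarrow> bool" where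
  "inversion_invariant c m \<longleftrightarrow> (\<forall>\<phi>\<in>B_space c. m (\<lambda>s. \<phi> (- s)) = m \<phi>)"


section \<open>Independence of the type carrying the Hilbert spaces\<close>

lemma complex_ring_simps [simp]:
  "carrier complex_ring = UNIV" "a \<otimes>\<^bsub>complex_ring\<^esub> b = a * b" "\<one>\<^bsub>complex_ring\<^esub> = 1"
  "\<zero>\<^bsub>complex_ring\<^esub> = 0" "a \<oplus>\<^bsub>complex_ring\<^esub> b = a + b"
  by (auto simp: complex_ring_def)

lemma cring_complex_ring: "cring complex_ring"
proof (rule cringI)
  show "abelian_group complex_ring"
  proof (rule abelian_groupI)
    show "\<exists>y\<in>carrier complex_ring. y \<oplus>\<^bsub>complex_ring\<^esub> x = \<zero>\<^bsub>complex_ring\<^esub>" for x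
      by (rule bexI[of _ "- x"]) auto
  qed auto
  show "comm_monoid complex_ring"
    by (rule comm_monoidI) auto
qed (auto simp: algebra_simps)

lemma uminus_complex_ring [simp]: "\<ominus>\<^bsub>complex_ring\<^esub> a = - a"
proof -
  interpret cring complex_ring by (rule cring_complex_ring)
  show ?thesis by (rule minus_equality) auto
qed

context complex_inner_space
begin

lemma smult_closed' [simp, intro]: "x \<in> carrier H \<Longrightarrow> a \<odot>\<^bsub>H\<^esub> x \<in> carrier H"
  by (rule smult_closed) simp_all

lemma smult_rules:
  "x \<in> carrier H \<Longrightarrow> 1 \<odot>\<^bsub>H\<^esub> x = x"
  "x \<in> carrier H \<Longrightarrow> 0 \<odot>\<^bsub>H\<^esub> x = \<zero>\<^bsub>H\<^esub>"
  "x \<in> carrier H \<Longrightarrow> (a * b) \<odot>\<^bsub>H\<^esub> x = a \<odot>\<^bsub>H\<^esub> (b \<odot>\<^bsub>H\<^esub> x)"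
  "x \<in> carrier H \<Longrightarrow> (a + b) \<odot>\<^bsub>H\<^esub> x = a \<odot>\<^bsub>H\<^esub> x \<oplus>\<^bsub>H\<^esub> b \<odot>\<^bsub>H\<^esub> x"
  "\<lbrakk>x \<in> carrier H; y \<in> carrier H\<rbrakk> \<Longrightarrow> a \<odot>\<^bsub>H\<^esub> (x \<oplus>\<^bsub>H\<^esub> y) = a \<odot>\<^bsub>H\<^esub> x \<oplus>\<^bsub>H\<^esub> a \<odot>\<^bsub>H\<^esub> y"
  "x \<in> carrier H \<Longrightarrow> (- a) \<odot>\<^bsub>H\<^esub> x = \<ominus>\<^bsub>H\<^esub> (a \<odot>\<^bsub>H\<^esub> x)"
  using smult_one[of x] smult_l_null[of x] smult_assoc1[of a b x] smult_l_distr[of a b x]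
    smult_r_distr[of a x y] smult_l_minus[of a x]
  by auto

lemma minus_smult: "x \<in> carrier H \<Longrightarrow> y \<in> carrier H \<Longrightarrow> x \<ominus>\<^bsub>H\<^esub> y = x \<oplus>\<^bsub>H\<^esub> (-1) \<odot>\<^bsub>H\<^esub> y"
  by (simp add: M.minus_eq smult_rules)

lemma minus_eq_zero: "x \<in> carrier H \<Longrightarrow> y \<in> carrier H \<Longrightarrow> x \<ominus>\<^bsub>H\<^esub> y = \<zero>\<^bsub>H\<^esub> \<longleftrightarrow> x = y"
  by (metis M.a_inv_closed M.minus_eq M.minus_equality M.minus_minus M.r_neg)

lemma cinner_add_right: "\<lbrakk>x \<in> carrier H; y \<in> carrier H; z \<in> carrier H\<rbrakk> \<Longrightarrow>
    cinner H z (x \<oplus>\<^bsub>H\<^esub> y) = cinner H z x + cinner H z y"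
  using cinner_add_left[of x y z] cinner_commute by (metis M.a_closed complex_cnj_add)

lemma cinner_smult_right: "\<lbrakk>x \<in> carrier H; y \<in> carrier H\<rbrakk> \<Longrightarrow>
    cinner H y (a \<odot>\<^bsub>H\<^esub> x) = cnj a * cinner H y x"
  using cinner_smult_left[of x y a] cinner_commute by (metis smult_closed' complex_cnj_mult)

lemma cinner_diff_left: "\<lbrakk>x \<in> carrier H; y \<in> carrier H; z \<in> carrier H\<rbrakk> \<Longrightarrow>
    cinner H (x \<ominus>\<^bsub>H\<^esub> y) z = cinner H x z - cinner H y z"
  by (simp add: minus_smult cinner_add_left cinner_smult_left)

lemma cinner_zero_left [simp]: "x \<in> carrier H \<Longrightarrow> cinner H \<zero>\<^bsub>H\<^esub> x = 0"
  using cinner_smult_left[of "\<zero>\<^bsub>H\<^esub>" x 0] smult_rules(2)[of "\<zero>\<^bsub>H\<^esub>"] by simp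

lemma cinner_self: "x \<in> carrier H \<Longrightarrow> cinner H x x = of_real ((hnorm H x)\<^sup>2)"
  using cinner_nonneg[of x] by (auto simp: hnorm_def nonneg_Reals_def simp flip: of_real_power)

lemma hnorm_nonneg [simp]: "x \<in> carrier H \<Longrightarrow> 0 \<le> hnorm H x"
  using cinner_nonneg[of x] by (auto simp: hnorm_def nonneg_Reals_def)

lemma hnorm_zero [simp]: "hnorm H \<zero>\<^bsub>H\<^esub> = 0"
  by (simp add: hnorm_def)

lemma hnorm_eq_0: "x \<in> carrier H \<Longrightarrow> hnorm H x = 0 \<longleftrightarrow> x = \<zero>\<^bsub>H\<^esub>"
  using cinner_definite[of x] cinner_self[of x] by auto

lemma hnorm_smult: "x \<in> carrier H \<Longrightarrow> hnorm H (a \<odot>\<^bsub>H\<^esub> x) = cmod a * hnorm H x"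
proof -
  assume x: "x \<in> carrier H"
  have "cinner H (a \<odot>\<^bsub>H\<^esub> x) (a \<odot>\<^bsub>H\<^esub> x) = (a * cnj a) * cinner H x x"
    using x by (simp add: cinner_smult_left cinner_smult_right)
  also have "\<dots> = of_real ((cmod a * hnorm H x)\<^sup>2)"
    using x by (simp only: cinner_self complex_norm_square[symmetric] power_mult_distrib of_real_mult)
  finally have "Re (cinner H (a \<odot>\<^bsub>H\<^esub> x) (a \<odot>\<^bsub>H\<^esub> x)) = (cmod a * hnorm H x)\<^sup>2"
    by (metis Re_complex_of_real)
  then show ?thesis
    using x by (simp add: hnorm_def[of H "a \<odot>\<^bsub>H\<^esub> x"])
qed

lemma Cauchy_Schwarz:
  assumes x: "x \<in> carrier H" and y: "y \<in> carrier H"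
  shows "cmod (cinner H x y) \<le> hnorm H x * hnorm H y"
proof (cases "y = \<zero>\<^bsub>H\<^esub>")
  case True
  then show ?thesis using x cinner_commute[of x "\<zero>\<^bsub>H\<^esub>"] by simp
next
  case False
  let ?n = "hnorm H y"
  let ?p = "cinner H x y"
  have n: "?n > 0" using False hnorm_eq_0[OF y] hnorm_nonneg[OF y] by linarith
  define a where "a = - ?p / of_real (?n\<^sup>2)"
  have pp: "?p * cnj ?p = of_real ((cmod ?p)\<^sup>2)"
    by (rule complex_norm_square[symmetric])
  have yx: "cinner H y x = cnj ?p" by (rule cinner_commute[OF y x])
  have "of_real ((hnorm H (x \<oplus>\<^bsub>H\<^esub> a \<odot>\<^bsub>H\<^esub> y))\<^sup>2) =
      cinner H (x \<oplus>\<^bsub>H\<^esub> a \<odot>\<^bsub>H\<^esub> y) (x \<oplus>\<^bsub>H\<^esub> a \<odot>\<^bsub>H\<^esub> y)"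
    using x y by (simp add: cinner_self)
  also have "\<dots> = cinner H x x + cnj a * ?p + a * cnj ?p + a * cnj a * cinner H y y"
    using x y by (simp add: cinner_add_left cinner_add_right cinner_smult_left cinner_smult_right
        yx algebra_simps)
  also have "\<dots> = of_real ((hnorm H x)\<^sup>2) - ?p * cnj ?p / of_real (?n\<^sup>2)"
    using n by (simp add: cinner_self[OF x] cinner_self[OF y] a_def field_simps power2_eq_square)
  also have "\<dots> = of_real ((hnorm H x)\<^sup>2 - (cmod ?p)\<^sup>2 / ?n\<^sup>2)"
    by (simp only: pp) simp
  finally have "(hnorm H (x \<oplus>\<^bsub>H\<^esub> a \<odot>\<^bsub>H\<^esub> y))\<^sup>2 = (hnorm H x)\<^sup>2 - (cmod ?p)\<^sup>2 / ?n\<^sup>2"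
    by (simp only: of_real_eq_iff)
  then have "(cmod ?p)\<^sup>2 / ?n\<^sup>2 \<le> (hnorm H x)\<^sup>2"
    by (metis diff_ge_0_iff_ge zero_le_power2)
  then have "(cmod ?p)\<^sup>2 \<le> (hnorm H x * ?n)\<^sup>2"
    using n by (simp add: field_simps power_mult_distrib)
  then show ?thesis by (rule power2_le_imp_le) (use x y in simp)
qed

lemma hnorm_triangle:
  assumes x: "x \<in> carrier H" and y: "y \<in> carrier H"
  shows "hnorm H (x \<oplus>\<^bsub>H\<^esub> y) \<le> hnorm H x + hnorm H y"
proof -
  have "of_real ((hnorm H (x \<oplus>\<^bsub>H\<^esub> y))\<^sup>2) =
      of_real ((hnorm H x)\<^sup>2) + of_real ((hnorm H y)\<^sup>2) + (cinner H x y + cnj (cinner H x y))"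
    using x y cinner_commute[OF y x]
    by (simp add: cinner_self[symmetric] cinner_add_left cinner_add_right del: of_real_power)
  also have "cinner H x y + cnj (cinner H x y) = of_real (2 * Re (cinner H x y))"
    by (simp add: complex_add_cnj)
  finally have "(hnorm H (x \<oplus>\<^bsub>H\<^esub> y))\<^sup>2 = (hnorm H x)\<^sup>2 + (hnorm H y)\<^sup>2 + 2 * Re (cinner H x y)"
    by (metis of_real_add of_real_eq_iff)
  moreover have "Re (cinner H x y) \<le> hnorm H x * hnorm H y"
    using Cauchy_Schwarz[OF x y] complex_Re_le_cmod order_trans by blast
  ultimately have "(hnorm H (x \<oplus>\<^bsub>H\<^esub> y))\<^sup>2 \<le> (hnorm H x + hnorm H y)\<^sup>2"
    by (simp add: power2_sum)
  then show ?thesis by (rule power2_le_imp_le) (use x y in simp)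
qed

lemma Metric_space_hdist: "Metric_space (carrier H) (hdist H)"
proof
  show "0 \<le> hdist H x y" for x y
    by (simp add: hdist_def)
  show "hdist H x y = hdist H y x" for x y
  proof -
    have "hnorm H (x \<ominus>\<^bsub>H\<^esub> y) = hnorm H (y \<ominus>\<^bsub>H\<^esub> x)" if "x \<in> carrier H" "y \<in> carrier H"
    proof -
      have "y \<ominus>\<^bsub>H\<^esub> x = (-1) \<odot>\<^bsub>H\<^esub> (x \<ominus>\<^bsub>H\<^esub> y)"
        using that by (simp add: minus_smult smult_rules M.a_comm)
      then show ?thesis using that hnorm_smult[of "x \<ominus>\<^bsub>H\<^esub> y" "-1"] by simp
    qed
    then show ?thesis by (simp add: hdist_def)
  qed
  show "hdist H x y = 0 \<longleftrightarrow> x = y" if "x \<in> carrier H" "y \<in> carrier H" for x y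
    using that by (simp add: hdist_def hnorm_eq_0 minus_eq_zero)
  show "hdist H x z \<le> hdist H x y + hdist H y z"
    if "x \<in> carrier H" "y \<in> carrier H" "z \<in> carrier H" for x y z
  proof -
    have "x \<ominus>\<^bsub>H\<^esub> z = (x \<ominus>\<^bsub>H\<^esub> y) \<oplus>\<^bsub>H\<^esub> (y \<ominus>\<^bsub>H\<^esub> z)"
      using that by (simp add: M.minus_eq M.a_assoc M.r_neg1 M.r_neg2)
    then show ?thesis
      using that hnorm_triangle[of "x \<ominus>\<^bsub>H\<^esub> y" "y \<ominus>\<^bsub>H\<^esub> z"] by (simp add: hdist_def)
  qed
qed

sublocale metric: Metric_space "carrier H" "hdist H"
  by (rule Metric_space_hdist)

end

lemma complex_hilbert_space_pullback:
  fixes H :: "'h inner_module" and H' :: "'k inner_module" and f :: "'k \<Rightarrow> 'h"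
  assumes H: "complex_hilbert_space H"
    and f: "\<And>x. x \<in> carrier H' \<Longrightarrow> f x \<in> carrier H" and inj: "inj_on f (carrier H')"
    and zero: "\<zero>\<^bsub>H'\<^esub> \<in> carrier H'" "f \<zero>\<^bsub>H'\<^esub> = \<zero>\<^bsub>H\<^esub>"
    and add: "\<And>x y. \<lbrakk>x \<in> carrier H'; y \<in> carrier H'\<rbrakk> \<Longrightarrow> x \<oplus>\<^bsub>H'\<^esub> y \<in> carrier H'"
      "\<And>x y. \<lbrakk>x \<in> carrier H'; y \<in> carrier H'\<rbrakk> \<Longrightarrow> f (x \<oplus>\<^bsub>H'\<^esub> y) = f x \<oplus>\<^bsub>H\<^esub> f y"
    and smult: "\<And>a x. x \<in> carrier H' \<Longrightarrow> a \<odot>\<^bsub>H'\<^esub> x \<in> carrier H'"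
      "\<And>a x. x \<in> carrier H' \<Longrightarrow> f (a \<odot>\<^bsub>H'\<^esub> x) = a \<odot>\<^bsub>H\<^esub> f x"
    and inner: "\<And>x y. \<lbrakk>x \<in> carrier H'; y \<in> carrier H'\<rbrakk> \<Longrightarrow> cinner H' x y = cinner H (f x) (f y)"
    and closed: "closedin (htopology H) (f ` carrier H')"
  shows "complex_hilbert_space H'"
    and "\<And>x. x \<in> carrier H' \<Longrightarrow> hnorm H' x = hnorm H (f x)"
    and "\<And>x y. \<lbrakk>x \<in> carrier H'; y \<in> carrier H'\<rbrakk> \<Longrightarrow> hdist H' x y = hdist H (f x) (f y)"
proof -
  interpret H: complex_hilbert_space H by (rule H)
  have eqI: "x = y" if "f x = f y" "x \<in> carrier H'" "y \<in> carrier H'" for x y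
    using inj that by (simp add: inj_on_def)
  note hom = f zero add smult
  have "abelian_group H'"
  proof (rule abelian_groupI)
    show "x \<oplus>\<^bsub>H'\<^esub> y \<oplus>\<^bsub>H'\<^esub> z = x \<oplus>\<^bsub>H'\<^esub> (y \<oplus>\<^bsub>H'\<^esub> z)"
      if "x \<in> carrier H'" "y \<in> carrier H'" "z \<in> carrier H'" for x y z
      by (rule eqI) (use that in \<open>simp_all add: hom H.M.a_assoc\<close>)
    show "x \<oplus>\<^bsub>H'\<^esub> y = y \<oplus>\<^bsub>H'\<^esub> x" if "x \<in> carrier H'" "y \<in> carrier H'" for x y
      by (rule eqI) (use that in \<open>simp_all add: hom H.M.a_comm\<close>)
    show "\<zero>\<^bsub>H'\<^esub> \<oplus>\<^bsub>H'\<^esub> x = x" if "x \<in> carrier H'" for x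
      by (rule eqI) (use that in \<open>simp_all add: hom\<close>)
    show "\<exists>y\<in>carrier H'. y \<oplus>\<^bsub>H'\<^esub> x = \<zero>\<^bsub>H'\<^esub>" if "x \<in> carrier H'" for x
    proof (rule bexI)
      show "(-1) \<odot>\<^bsub>H'\<^esub> x \<oplus>\<^bsub>H'\<^esub> x = \<zero>\<^bsub>H'\<^esub>"
        by (rule eqI) (use that in \<open>simp_all add: hom H.smult_rules H.M.l_neg\<close>)
    qed (use that in \<open>simp add: hom\<close>)
  qed (use hom in auto)
  then have "Module.module complex_ring H'"
  proof (rule moduleI[OF cring_complex_ring])
    show "(a \<oplus>\<^bsub>complex_ring\<^esub> b) \<odot>\<^bsub>H'\<^esub> x = a \<odot>\<^bsub>H'\<^esub> x \<oplus>\<^bsub>H'\<^esub> b \<odot>\<^bsub>H'\<^esub> x"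
      if "x \<in> carrier H'" for a b x
      by (rule eqI) (use that in \<open>simp_all add: hom H.smult_rules\<close>)
    show "a \<odot>\<^bsub>H'\<^esub> (x \<oplus>\<^bsub>H'\<^esub> y) = a \<odot>\<^bsub>H'\<^esub> x \<oplus>\<^bsub>H'\<^esub> a \<odot>\<^bsub>H'\<^esub> y"
      if "x \<in> carrier H'" "y \<in> carrier H'" for a x y
      by (rule eqI) (use that in \<open>simp_all add: hom H.smult_rules\<close>)
    show "(a \<otimes>\<^bsub>complex_ring\<^esub> b) \<odot>\<^bsub>H'\<^esub> x = a \<odot>\<^bsub>H'\<^esub> (b \<odot>\<^bsub>H'\<^esub> x)"
      if "x \<in> carrier H'" for a b x
      by (rule eqI) (use that in \<open>simp_all add: hom H.smult_rules\<close>)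
    show "\<one>\<^bsub>complex_ring\<^esub> \<odot>\<^bsub>H'\<^esub> x = x" if "x \<in> carrier H'" for x
      by (rule eqI) (use that in \<open>simp_all add: hom H.smult_rules\<close>)
  qed (use hom in auto)
  then have "complex_inner_space H'"
  proof (rule complex_inner_space.intro[OF _ complex_inner_space_axioms.intro])
    show "cinner H' x y = cnj (cinner H' y x)" if "x \<in> carrier H'" "y \<in> carrier H'" for x y
      unfolding inner[OF that] inner[OF that(2,1)] using that by (intro H.cinner_commute f)
    show "x = \<zero>\<^bsub>H'\<^esub>" if "x \<in> carrier H'" "cinner H' x x = 0" for x
      by (rule eqI) (use that H.cinner_definite[of "f x"] in \<open>simp_all add: hom inner\<close>)
  qed (use hom in \<open>auto simp: inner H.cinner_add_left H.cinner_smult_left H.cinner_nonneg\<close>)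
  then interpret H': complex_inner_space H' .
  show norm: "hnorm H' x = hnorm H (f x)" if "x \<in> carrier H'" for x
    using that by (simp add: hnorm_def inner)
  show dist: "hdist H' x y = hdist H (f x) (f y)" if "x \<in> carrier H'" "y \<in> carrier H'" for x y
    using that by (simp add: hdist_def norm hom H.minus_smult H'.minus_smult)
  have "H'.metric.mcomplete"
    unfolding H'.metric.mcomplete_def
  proof (intro allI impI)
    fix \<sigma> assume \<sigma>: "H'.metric.MCauchy \<sigma>"
    then have ran: "\<sigma> n \<in> carrier H'" for n
      by (auto simp: H'.metric.MCauchy_def)
    have "H.metric.MCauchy (f \<circ> \<sigma>)"
      using \<sigma> ran by (auto simp: H'.metric.MCauchy_def H.metric.MCauchy_def dist f)
    then obtain l where l: "limitin (htopology H) (f \<circ> \<sigma>) l sequentially"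
      using H.complete by (auto simp: H.metric.mcomplete_def)
    have "range (f \<circ> \<sigma>) \<subseteq> f ` carrier H'"
      using ran by auto
    then have "l \<in> f ` carrier H'"
      using closed l unfolding H.metric.metric_closedin_iff_sequentially_closed by blast
    then obtain k where k: "k \<in> carrier H'" "l = f k" by blast
    then have "limitin (htopology H') \<sigma> k sequentially"
      using l ran by (auto simp: H.metric.limit_metric_sequentially
          H'.metric.limit_metric_sequentially dist f)
    then show "\<exists>x. limitin (htopology H') \<sigma> x sequentially" ..
  qed
  then show "complex_hilbert_space H'"
    by unfold_locales
qed

lemma op_norm_bound:
  assumes H: "complex_hilbert_space H" and T: "bounded_operator H T"
  shows "x \<in> carrier H \<Longrightarrow> hnorm H (T x) \<le> op_norm H T * hnorm H x"
    and "0 \<le> op_norm H T"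
proof -
  interpret complex_hilbert_space H by (rule H)
  obtain K where K: "\<And>x. x \<in> carrier H \<Longrightarrow> hnorm H (T x) \<le> K * hnorm H x"
    using T unfolding bounded_operator_def by blast
  have "hnorm H (T y) / hnorm H y \<le> max K 0" if "y \<in> carrier H" for y
  proof (cases "hnorm H y = 0")
    case False
    then have "hnorm H y > 0" using that hnorm_nonneg[of y] by linarith
    then have "hnorm H (T y) / hnorm H y \<le> K" using K[OF that] by (simp add: divide_le_eq)
    then show ?thesis by simp
  qed simp
  then have "bdd_above ((\<lambda>y. hnorm H (T y) / hnorm H y) ` carrier H)"
    by (auto intro!: bdd_aboveI)
  then have le: "hnorm H (T x) / hnorm H x \<le> op_norm H T" if "x \<in> carrier H" for x
    unfolding op_norm_def using that by (rule cSUP_upper[rotated])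
  show "0 \<le> op_norm H T"
    using le[OF M.zero_closed] by simp
  assume x: "x \<in> carrier H"
  show "hnorm H (T x) \<le> op_norm H T * hnorm H x"
  proof (cases "hnorm H x = 0")
    case True
    then show ?thesis using K[OF x] by simp
  next
    case False
    then have "hnorm H x > 0" using x hnorm_nonneg[of x] by linarith
    then show ?thesis using le[OF x] by (simp add: divide_le_eq)
  qed
qed

lemma op_norm_leI:
  assumes H: "complex_hilbert_space H" and c: "c \<ge> 0"
    and "\<And>x. x \<in> carrier H \<Longrightarrow> hnorm H (T x) \<le> c * hnorm H x"
  shows "op_norm H T \<le> c"
proof -
  interpret complex_hilbert_space H by (rule H)
  show ?thesis
    unfolding op_norm_def
  proof (rule cSUP_least)
    show "carrier H \<noteq> {}" using M.zero_closed by blast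
    show "hnorm H (T x) / hnorm H x \<le> c" if "x \<in> carrier H" for x
    proof (cases "hnorm H x = 0")
      case False
      then have "hnorm H x > 0" using that hnorm_nonneg[of x] by linarith
      then show ?thesis using assms(3)[OF that] by (simp add: divide_le_eq)
    qed (use c in simp)
  qed
qed

theorem coefficient_in_B_space:
  fixes H :: "'h inner_module" and \<pi> :: "'g::topological_group_add \<Rightarrow> 'h \<Rightarrow> 'h"
  assumes H: "complex_hilbert_space H" and rep: "bounded_representation c H \<pi>"
    and \<xi>: "\<xi> \<in> carrier H" and \<eta>: "\<eta> \<in> carrier H"
  shows "(\<lambda>s. cinner H (\<pi> s \<xi>) \<eta>) \<in> B_space c"
proof -
  interpret H: complex_hilbert_space H by (rule H)
  have inv: "invertible_operator H (\<pi> s)" and bnd: "bounded_operator H (\<pi> s)"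
    and op: "op_norm H (\<pi> s) \<le> c" for s
    using rep by (auto simp: bounded_representation_def invertible_operator_def)
  have mult: "\<pi> (s + t) x = \<pi> s (\<pi> t x)" if "x \<in> carrier H" for s t x
    using rep that by (auto simp: bounded_representation_def)
  have cont: "continuous_map euclidean (htopology H) (\<lambda>s. \<pi> s x)" if "x \<in> carrier H" for x
    using rep that by (auto simp: bounded_representation_def)
  have cl: "\<pi> s x \<in> carrier H" if "x \<in> carrier H" for s x
    using bnd[of s] that by (auto simp: bounded_operator_def)
  have lin: "\<lbrakk>x \<in> carrier H; y \<in> carrier H\<rbrakk> \<Longrightarrow> \<pi> s (x \<oplus>\<^bsub>H\<^esub> y) = \<pi> s x \<oplus>\<^bsub>H\<^esub> \<pi> s y"
    "x \<in> carrier H \<Longrightarrow> \<pi> s (a \<odot>\<^bsub>H\<^esub> x) = a \<odot>\<^bsub>H\<^esub> \<pi> s x" for s x y a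
    using bnd[of s] by (auto simp: bounded_operator_def)
  have \<pi>0: "\<pi> s \<zero>\<^bsub>H\<^esub> = \<zero>\<^bsub>H\<^esub>" for s
    using lin(2)[of "\<zero>\<^bsub>H\<^esub>" s 0] cl by (simp add: H.smult_rules)
  have one: "\<pi> 0 x = x" if "x \<in> carrier H" for x
  proof -
    obtain S where S: "\<And>y. y \<in> carrier H \<Longrightarrow> S (\<pi> 0 y) = y"
      using inv[of 0] by (auto simp: invertible_operator_def)
    have "\<pi> 0 (\<pi> 0 x) = \<pi> 0 x" using mult[OF that, of 0 0] by simp
    then show ?thesis using S[OF cl[OF that, of 0]] S[OF that] by metis
  qed
  have bound: "hnorm H (\<pi> s x) \<le> c * hnorm H x" if "x \<in> carrier H" for s x
    using op_norm_bound(1)[OF H bnd that, of s] op[of s] H.hnorm_nonneg[OF that]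
    by (meson mult_right_mono order_trans)

  text \<open>\<open>K\<close> is the closed invariant subspace generated by \<open>\<xi>\<close> and \<open>\<eta>\<close>; its elements are determined
    by their inner products with the orbits of \<open>\<xi>\<close> and \<open>\<eta>\<close>.\<close>

  define sub where "sub S \<longleftrightarrow> closedin (htopology H) S \<and> \<zero>\<^bsub>H\<^esub> \<in> S \<and>
      (\<forall>x\<in>S. \<forall>y\<in>S. x \<oplus>\<^bsub>H\<^esub> y \<in> S) \<and> (\<forall>a. \<forall>x\<in>S. a \<odot>\<^bsub>H\<^esub> x \<in> S) \<and>
      (\<forall>s. \<forall>x\<in>S. \<pi> s x \<in> S) \<and> \<xi> \<in> S \<and> \<eta> \<in> S" for S
  define K where "K = \<Inter>{S. sub S}"
  have "sub (carrier H)"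
    using \<xi> \<eta> cl closedin_topspace[of "htopology H"] by (auto simp: sub_def)
  then have KC: "K \<subseteq> carrier H" and ne: "{S. sub S} \<noteq> {}"
    by (auto simp: K_def)
  have "closedin (htopology H) K"
    unfolding K_def by (rule closedin_Inter[OF ne]) (auto simp: sub_def)
  then have subK: "sub K"
    by (auto simp: sub_def K_def)
  have KI: "x \<in> carrier H" if "x \<in> K" for x using KC that by blast
  have KK: "\<lbrakk>x \<in> K; y \<in> K\<rbrakk> \<Longrightarrow> x \<oplus>\<^bsub>H\<^esub> y \<in> K" "x \<in> K \<Longrightarrow> a \<odot>\<^bsub>H\<^esub> x \<in> K"
    "x \<in> K \<Longrightarrow> \<pi> s x \<in> K" for x y a s
    using subK by (auto simp: sub_def)
  have K0: "\<zero>\<^bsub>H\<^esub> \<in> K" "\<xi> \<in> K" "\<eta> \<in> K"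
    using subK by (auto simp: sub_def)

  define \<Phi> where "\<Phi> x = (\<lambda>s. (cinner H x (\<pi> s \<xi>), cinner H x (\<pi> s \<eta>)))" for x
  have inj: "inj_on \<Phi> K"
  proof (rule inj_onI)
    fix x y assume x: "x \<in> K" and y: "y \<in> K" and eq: "\<Phi> x = \<Phi> y"
    define d where "d = x \<ominus>\<^bsub>H\<^esub> y"
    have dK: "d \<in> K"
      using x y KI KK by (simp add: d_def H.minus_smult)
    have dH: "d \<in> carrier H" using dK KI by blast
    define P where "P = {z \<in> carrier H. \<forall>s. cinner H (\<pi> s z) d = 0}"
    have orth: "cinner H (\<pi> s \<xi>) d = 0" "cinner H (\<pi> s \<eta>) d = 0" for s
    proof -
      have "cinner H d (\<pi> s \<xi>) = 0" "cinner H d (\<pi> s \<eta>) = 0"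
        using fun_cong[OF eq, of s] x y KI cl \<xi> \<eta> by (auto simp: d_def \<Phi>_def H.cinner_diff_left)
      then show "cinner H (\<pi> s \<xi>) d = 0" "cinner H (\<pi> s \<eta>) d = 0"
        using H.cinner_commute[OF cl[OF \<xi>] dH, of s] H.cinner_commute[OF cl[OF \<eta>] dH, of s]
        by auto
    qed
    have "closedin (htopology H) P"
      unfolding H.metric.metric_closedin_iff_sequentially_closed
    proof (intro conjI allI impI)
      show "P \<subseteq> carrier H" by (auto simp: P_def)
      fix \<sigma> l assume "range \<sigma> \<subseteq> P \<and> limitin (htopology H) \<sigma> l sequentially"
      then have \<sigma>: "\<And>n. \<sigma> n \<in> P" and l: "l \<in> carrier H"
        and lim: "\<And>e. e > 0 \<Longrightarrow> \<exists>N. \<forall>n\<ge>N. hdist H (\<sigma> n) l < e"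
        unfolding H.metric.limit_metric_sequentially by blast+
      have \<sigma>H: "\<sigma> n \<in> carrier H" and \<sigma>P: "cinner H (\<pi> s (\<sigma> n)) d = 0" for n s
        using \<sigma>[of n] by (auto simp: P_def)
      have est: "cmod (cinner H (\<pi> s l) d) \<le> (c * hnorm H d) * hdist H (\<sigma> n) l" for s n
      proof -
        have "\<pi> s (\<sigma> n \<ominus>\<^bsub>H\<^esub> l) = \<pi> s (\<sigma> n) \<ominus>\<^bsub>H\<^esub> \<pi> s l"
          using \<sigma>H l cl by (simp add: H.minus_smult lin)
        then have "cinner H (\<pi> s (\<sigma> n \<ominus>\<^bsub>H\<^esub> l)) d = - cinner H (\<pi> s l) d"
          using \<sigma>H l dH cl \<sigma>P by (simp add: H.cinner_diff_left)
        then have "cmod (cinner H (\<pi> s l) d) \<le> hnorm H (\<pi> s (\<sigma> n \<ominus>\<^bsub>H\<^esub> l)) * hnorm H d"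
          using H.Cauchy_Schwarz[OF cl dH, of "\<sigma> n \<ominus>\<^bsub>H\<^esub> l" s] \<sigma>H l by simp
        also have "\<dots> \<le> (c * hnorm H (\<sigma> n \<ominus>\<^bsub>H\<^esub> l)) * hnorm H d"
          using bound[of "\<sigma> n \<ominus>\<^bsub>H\<^esub> l" s] \<sigma>H l dH by (intro mult_right_mono) auto
        finally show ?thesis using \<sigma>H l by (simp add: hdist_def algebra_simps)
      qed
      have "cinner H (\<pi> s l) d = 0" for s
      proof (rule ccontr)
        assume "cinner H (\<pi> s l) d \<noteq> 0"
        then have pos: "cmod (cinner H (\<pi> s l) d) > 0" by simp
        define b where "b = \<bar>c * hnorm H d\<bar> + 1"
        have b: "b > 0" "c * hnorm H d \<le> b" by (auto simp: b_def)
        obtain n where n: "hdist H (\<sigma> n) l < cmod (cinner H (\<pi> s l) d) / b"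
          using lim[of "cmod (cinner H (\<pi> s l) d) / b"] pos b by auto
        have "cmod (cinner H (\<pi> s l) d) \<le> b * hdist H (\<sigma> n) l"
          using est[of s n] b mult_right_mono[OF b(2), of "hdist H (\<sigma> n) l"]
          by (meson H.metric.nonneg order_trans)
        then show False using n b by (simp add: field_simps)
      qed
      then show "l \<in> P" using l by (simp add: P_def)
    qed
    then have "sub P"
      unfolding sub_def
      using \<xi> \<eta> cl dH orth
      by (auto simp: P_def \<pi>0 lin H.cinner_add_left H.cinner_smult_left mult[symmetric])
    then have "d \<in> P" using dK by (auto simp: K_def)
    then have "cinner H (\<pi> 0 d) d = 0" unfolding P_def by blast
    then have "d = \<zero>\<^bsub>H\<^esub>" using one[OF dH] H.cinner_definite[OF dH] by simp
    then show "x = y" using x y KI H.minus_eq_zero by (simp add: d_def)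
  qed

  define \<Psi> where "\<Psi> = inv_into K \<Phi>"
  have \<Psi>\<Phi> [simp]: "\<Psi> (\<Phi> x) = x" if "x \<in> K" for x
    using inj that by (simp add: \<Psi>_def)
  define H' where "H' = \<lparr>carrier = \<Phi> ` K, mult = (\<lambda>u v. u), one = \<Phi> \<zero>\<^bsub>H\<^esub>, zero = \<Phi> \<zero>\<^bsub>H\<^esub>,
      add = (\<lambda>u v. \<Phi> (\<Psi> u \<oplus>\<^bsub>H\<^esub> \<Psi> v)), smult = (\<lambda>a u. \<Phi> (a \<odot>\<^bsub>H\<^esub> \<Psi> u)),
      cinner = (\<lambda>u v. cinner H (\<Psi> u) (\<Psi> v))\<rparr>"
  have H'_simps [simp]: "carrier H' = \<Phi> ` K" "\<zero>\<^bsub>H'\<^esub> = \<Phi> \<zero>\<^bsub>H\<^esub>" "u \<oplus>\<^bsub>H'\<^esub> v = \<Phi> (\<Psi> u \<oplus>\<^bsub>H\<^esub> \<Psi> v)"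
    "a \<odot>\<^bsub>H'\<^esub> u = \<Phi> (a \<odot>\<^bsub>H\<^esub> \<Psi> u)" "cinner H' u v = cinner H (\<Psi> u) (\<Psi> v)" for u v a
    by (simp_all add: H'_def)
  have im: "\<Psi> ` \<Phi> ` K = K" by force
  have H': "complex_hilbert_space H'"
    and norm0: "\<And>u. u \<in> carrier H' \<Longrightarrow> hnorm H' u = hnorm H (\<Psi> u)"
    and dist0: "\<And>u v. \<lbrakk>u \<in> carrier H'; v \<in> carrier H'\<rbrakk> \<Longrightarrow> hdist H' u v = hdist H (\<Psi> u) (\<Psi> v)"
  proof -
    have 1: "inj_on \<Psi> (carrier H')" by (auto simp: inj_on_def)
    have 2: "closedin (htopology H) (\<Psi> ` carrier H')" using subK im by (simp add: sub_def)
    note pb = complex_hilbert_space_pullback[OF H _ 1 _ _ _ _ _ _ _ 2]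
    show "complex_hilbert_space H'" by (rule pb(1)) (use KI KK K0 in auto)
    show "\<And>u. u \<in> carrier H' \<Longrightarrow> hnorm H' u = hnorm H (\<Psi> u)"
      by (rule pb(2)) (use KI KK K0 in auto)
    show "\<And>u v. \<lbrakk>u \<in> carrier H'; v \<in> carrier H'\<rbrakk> \<Longrightarrow> hdist H' u v = hdist H (\<Psi> u) (\<Psi> v)"
      by (rule pb(3)) (use KI KK K0 in auto)
  qed
  interpret H': complex_hilbert_space H' by (rule H')
  have norm': "hnorm H' (\<Phi> x) = hnorm H x" if "x \<in> K" for x
    using norm0[of "\<Phi> x"] that by simp
  have dist': "hdist H' (\<Phi> x) (\<Phi> y) = hdist H x y" if "x \<in> K" "y \<in> K" for x y
    using dist0[of "\<Phi> x" "\<Phi> y"] that by simp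

  define \<pi>' where "\<pi>' s u = \<Phi> (\<pi> s (\<Psi> u))" for s u
  have \<pi>' [simp]: "\<pi>' s (\<Phi> x) = \<Phi> (\<pi> s x)" if "x \<in> K" for s x
    using that by (simp add: \<pi>'_def)
  have bnd': "bounded_operator H' (\<pi>' s)" for s
    unfolding bounded_operator_def
  proof (intro conjI)
    show "\<exists>B. \<forall>u\<in>carrier H'. hnorm H' (\<pi>' s u) \<le> B * hnorm H' u"
      using bound KI KK(3) norm' by (auto intro!: exI[of _ c])
  qed (use KI KK in \<open>auto simp: lin\<close>)
  have "bounded_representation c H' \<pi>'"
    unfolding bounded_representation_def
  proof (intro conjI allI ballI)
    show "invertible_operator H' (\<pi>' s)" for s
    proof -
      have "\<pi>' (- s) (\<pi>' s u) = u" "\<pi>' s (\<pi>' (- s) u) = u" if "u \<in> carrier H'" for u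
        using that KI KK(3) by (auto simp: mult[symmetric] one)
      then show ?thesis using bnd' unfolding invertible_operator_def by blast
    qed
    show "\<pi>' (s + t) u = \<pi>' s (\<pi>' t u)" if "u \<in> carrier H'" for s t u
      using that KI KK(3) mult by auto
    show "continuous_map euclidean (htopology H') (\<lambda>s. \<pi>' s u)" if u: "u \<in> carrier H'" for u
    proof -
      obtain x where x: "x \<in> K" "u = \<Phi> x" using u by auto
      have mball: "\<Phi> y \<in> H'.metric.mball (\<Phi> z) e \<longleftrightarrow> y \<in> H.metric.mball z e"
        if "y \<in> K" "z \<in> K" for y z e
        unfolding H'.metric.in_mball H.metric.in_mball using that KI dist' by auto
      show ?thesis
        using cont[OF KI[OF x(1)]]
        unfolding H.metric.continuous_map_to_metric H'.metric.continuous_map_to_metric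
          x(2) \<pi>'[OF x(1)] mball[OF KK(3)[OF x(1)] KK(3)[OF x(1)]] .
    qed
    show "op_norm H' (\<pi>' s) \<le> c" for s
    proof (rule op_norm_leI[OF H'])
      show "c \<ge> 0" using op[of s] op_norm_bound(2)[OF H bnd[of s]] by simp
      show "hnorm H' (\<pi>' s u) \<le> c * hnorm H' u" if "u \<in> carrier H'" for u
        using that bound KI KK(3) norm' by auto
    qed
  qed
  moreover have "\<Phi> \<xi> \<in> carrier H'" "\<Phi> \<eta> \<in> carrier H'"
    using K0 by auto
  moreover have "(\<lambda>s. cinner H (\<pi> s \<xi>) \<eta>) = (\<lambda>s. cinner H' (\<pi>' s (\<Phi> \<xi>)) (\<Phi> \<eta>))"
    using K0 KK(3) by auto
  ultimately show ?thesis
    unfolding B_space_def using H' by blast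
qed

end

theory Submission
  imports Defs
begin

text \<open>
  Let \<open>\<phi>(s) = \<langle>\<pi>(s)\<xi>, \<eta>\<rangle>\<close> be a coefficient of a uniformly bounded representation.  The norm
  \<open>sup\<^sub>s \<parallel>\<pi>(s)x\<parallel>\<close> is equivalent to the Hilbert norm, invariant, and still uniformly convex, so the
  closed convex hull of the orbit of \<open>\<xi>\<close> has a unique element of minimal invariant norm, which is
  then a fixed vector.  Hence convex combinations of right translates of \<open>\<phi>\<close> converge uniformly to a
  constant.

  The same uniform convexity shows that the adjoint representation \<open>s \<mapsto> \<pi>(s\<inverse>)\<^sup>*\<close>, which is a priori
  only weakly continuous, is strongly continuous; this makes \<open>B\<^sub>c(G)\<close> closed under inversion, and
  convex combinations of left translates of \<open>\<phi>\<close> converge uniformly to a constant as well.  Left and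
  right averages commute, so the two constants agree.  An invariant mean does not change under left
  averaging and is continuous for the uniform norm, so its value at \<open>\<phi>\<close> has to be that constant;
  conversely this constant defines an invariant mean, which is inversion invariant because inversion
  exchanges left and right averages.
\<close>

subsection \<open>Minimizing sequences in Hilbert spaces\<close>

context complex_inner_space
begin

lemma hnorm_add_sq:
  assumes "x \<in> carrier H" "y \<in> carrier H"
  shows "(hnorm H (x \<oplus>\<^bsub>H\<^esub> y))\<^sup>2 = (hnorm H x)\<^sup>2 + (hnorm H y)\<^sup>2 + 2 * Re (cinner H x y)"
proof -
  have sq: "(hnorm H z)\<^sup>2 = Re (cinner H z z)" if "z \<in> carrier H" for z
    using cinner_self[OF that] by simp
  have "Re (cinner H y x) = Re (cinner H x y)"
    using cinner_commute[of x y] assms by simp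
  then show ?thesis
    using assms by (simp add: sq cinner_add_left cinner_add_right)
qed

lemma hnorm_diff_sq:
  assumes "x \<in> carrier H" "y \<in> carrier H"
  shows "(hnorm H (x \<ominus>\<^bsub>H\<^esub> y))\<^sup>2 = (hnorm H x)\<^sup>2 + (hnorm H y)\<^sup>2 - 2 * Re (cinner H x y)"
  using assms hnorm_add_sq[of x "(-1) \<odot>\<^bsub>H\<^esub> y"]
  by (simp add: minus_smult hnorm_smult cinner_smult_right)

lemma add_minus_cancel:
  assumes "x \<in> carrier H" "y \<in> carrier H"
  shows "x \<oplus>\<^bsub>H\<^esub> (y \<ominus>\<^bsub>H\<^esub> x) = y"
  unfolding M.minus_eq M.a_comm[OF assms(2) M.a_inv_closed[OF assms(1)]]
  by (rule M.r_neg2[OF assms])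

lemma hnorm_minus_commute:
  assumes "x \<in> carrier H" "y \<in> carrier H"
  shows "hnorm H (x \<ominus>\<^bsub>H\<^esub> y) = hnorm H (y \<ominus>\<^bsub>H\<^esub> x)"
  using metric.commute[of x y] assms by (simp add: hdist_def)

text \<open>Midpoints replace general convex combinations throughout: the parallelogram law speaks
  about them, and closure under them is easy to carry through inductions.\<close>

definition mid :: "'h \<Rightarrow> 'h \<Rightarrow> 'h" where
  "mid x y = (1/2) \<odot>\<^bsub>H\<^esub> (x \<oplus>\<^bsub>H\<^esub> y)"

lemma mid_closed [simp]: "\<lbrakk>x \<in> carrier H; y \<in> carrier H\<rbrakk> \<Longrightarrow> mid x y \<in> carrier H"
  by (simp add: mid_def)

lemma cinner_mid_left: "\<lbrakk>x \<in> carrier H; y \<in> carrier H; z \<in> carrier H\<rbrakk> \<Longrightarrow>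
    cinner H (mid x y) z = (cinner H x z + cinner H y z) / 2"
  by (simp add: mid_def cinner_add_left cinner_smult_left)

text \<open>The parallelogram law solved for the midpoint. The subtracted term is the uniform
  convexity on which the minimization arguments rest.\<close>

lemma hnorm_mid_sq:
  assumes "x \<in> carrier H" "y \<in> carrier H"
  shows "(hnorm H (mid x y))\<^sup>2 =
    ((hnorm H x)\<^sup>2 + (hnorm H y)\<^sup>2) / 2 - (hnorm H (x \<ominus>\<^bsub>H\<^esub> y))\<^sup>2 / 4"
proof -
  have "(hnorm H (mid x y))\<^sup>2 = (hnorm H (x \<oplus>\<^bsub>H\<^esub> y))\<^sup>2 / 4"
    using assms by (simp add: mid_def hnorm_smult power_mult_distrib power2_eq_square)
  then show ?thesis
    by (simp add: hnorm_add_sq[OF assms] hnorm_diff_sq[OF assms] field_simps)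
qed

end

section \<open>Completeness, convex minimization and the Riesz representation\<close>

lemma (in complex_hilbert_space) Cauchy_limit:
  assumes \<sigma>: "\<And>n. \<sigma> n \<in> carrier H"
    and C: "\<And>e. e > 0 \<Longrightarrow> \<exists>N. \<forall>m\<ge>N. \<forall>n\<ge>N. hnorm H (\<sigma> m \<ominus>\<^bsub>H\<^esub> \<sigma> n) < e"
  obtains l where "l \<in> carrier H" "(\<lambda>n. hnorm H (\<sigma> n \<ominus>\<^bsub>H\<^esub> l)) \<longlonglongrightarrow> 0"
proof -
  have "metric.MCauchy \<sigma>"
    unfolding metric.MCauchy_def using \<sigma> C by (auto simp: hdist_def)
  then obtain l where "limitin (htopology H) \<sigma> l sequentially"
    using complete by (auto simp: metric.mcomplete_def)
  then have l: "l \<in> carrier H"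
    and lim: "\<And>e. e > 0 \<Longrightarrow> \<exists>N. \<forall>n\<ge>N. hdist H (\<sigma> n) l < e"
    unfolding metric.limit_metric_sequentially by blast+
  have "(\<lambda>n. hnorm H (\<sigma> n \<ominus>\<^bsub>H\<^esub> l)) \<longlonglongrightarrow> 0"
    unfolding LIMSEQ_iff using lim \<sigma> l by (simp add: hdist_def)
  with l show thesis by (rule that)
qed

text \<open>The midpoint of two near-minimizers has value at least the infimum, so
  \<open>conv\<close> bounds their squared distance by the mean of their excesses; a minimizing
  sequence is therefore Cauchy. The limit \<open>l\<close> may lie outside \<open>S\<close>, and
  \<open>q l\<close> may differ from the infimum.\<close>

lemma (in complex_hilbert_space) minimizing_sequence:
  fixes q :: "'h \<Rightarrow> real"
  assumes S: "S \<subseteq> carrier H" "S \<noteq> {}" and mid: "\<And>x y. \<lbrakk>x \<in> S; y \<in> S\<rbrakk> \<Longrightarrow> mid x y \<in> S"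
    and bdd: "bdd_below (q ` S)" and \<kappa>: "\<kappa> > 0"
    and conv: "\<And>x y. \<lbrakk>x \<in> S; y \<in> S\<rbrakk> \<Longrightarrow>
      q (mid x y) \<le> (q x + q y) / 2 - \<kappa> * (hnorm H (x \<ominus>\<^bsub>H\<^esub> y))\<^sup>2"
  obtains \<sigma> l where "\<And>n. \<sigma> n \<in> S" "l \<in> carrier H"
    "(\<lambda>n. hnorm H (\<sigma> n \<ominus>\<^bsub>H\<^esub> l)) \<longlonglongrightarrow> 0" "(\<lambda>n. q (\<sigma> n)) \<longlonglongrightarrow> (INF x\<in>S. q x)"
proof -
  define I where "I = (INF x\<in>S. q x)"
  have I: "I \<le> q x" if "x \<in> S" for x
    unfolding I_def by (rule cINF_lower[OF bdd that])
  have "\<exists>x\<in>S. q x < I + 1 / Suc n" for n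
    using cInf_lessD[of "q ` S" "I + 1 / Suc n"] S(2) by (auto simp: I_def)
  then obtain \<sigma> where \<sigma>: "\<And>n. \<sigma> n \<in> S" and less: "\<And>n. q (\<sigma> n) < I + 1 / Suc n"
    by metis
  have est: "\<kappa> * (hnorm H (x \<ominus>\<^bsub>H\<^esub> y))\<^sup>2 \<le> (q x + q y) / 2 - I" if "x \<in> S" "y \<in> S" for x y
    using conv[OF that] I[OF mid[OF that]] by simp
  have C: "\<exists>N. \<forall>m\<ge>N. \<forall>n\<ge>N. hnorm H (\<sigma> m \<ominus>\<^bsub>H\<^esub> \<sigma> n) < e" if e: "e > 0" for e
  proof -
    obtain N where N: "1 / Suc N < \<kappa> * e\<^sup>2"
      using reals_Archimedean[of "\<kappa> * e\<^sup>2"] \<kappa> e by (auto simp: inverse_eq_divide)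
    define u where "u = 1 / real (Suc N)"
    have "hnorm H (\<sigma> m \<ominus>\<^bsub>H\<^esub> \<sigma> n) < e" if "m \<ge> N" "n \<ge> N" for m n
    proof -
      have near: "q (\<sigma> k) < I + u" if "k \<ge> N" for k
      proof -
        have "1 / real (Suc k) \<le> 1 / Suc N" using that by (intro divide_left_mono) auto
        then show ?thesis using less[of k] unfolding u_def by linarith
      qed
      have "(q (\<sigma> m) + q (\<sigma> n)) / 2 - I < u"
        using near[OF that(1)] near[OF that(2)] by (simp add: field_simps)
      then have "\<kappa> * (hnorm H (\<sigma> m \<ominus>\<^bsub>H\<^esub> \<sigma> n))\<^sup>2 < \<kappa> * e\<^sup>2"
        using est[OF \<sigma>[of m] \<sigma>[of n]] N[folded u_def] by (meson le_less_trans less_trans)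
      then show ?thesis using \<kappa> e by (simp add: power_less_imp_less_base)
    qed
    then show ?thesis by blast
  qed
  obtain l where l: "l \<in> carrier H" "(\<lambda>n. hnorm H (\<sigma> n \<ominus>\<^bsub>H\<^esub> l)) \<longlonglongrightarrow> 0"
    using Cauchy_limit[of \<sigma>] \<sigma> S C by blast
  have "(\<lambda>n. q (\<sigma> n)) \<longlonglongrightarrow> I"
  proof (rule tendsto_sandwich[of "\<lambda>n. I"])
    show "(\<lambda>n. I + 1 / real (Suc n)) \<longlonglongrightarrow> I"
      using tendsto_add[OF tendsto_const LIMSEQ_inverse_real_of_nat, of I]
      by (simp add: inverse_eq_divide)
  qed (use I \<sigma> less in \<open>auto intro!: always_eventually less_imp_le\<close>)
  with \<sigma> l show thesis by (intro that) (simp_all add: I_def)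
qed

text \<open>If \<open>l\<close> represents \<open>f\<close>, then \<open>q x\<close> in the proof is
  the squared distance from \<open>x\<close> to \<open>l\<close> minus the square of
  \<open>hnorm H l\<close>. Minimizing \<open>q\<close> thus finds the representing vector.\<close>

theorem (in complex_hilbert_space) Riesz_representation:
  assumes add: "\<And>x y. \<lbrakk>x \<in> carrier H; y \<in> carrier H\<rbrakk> \<Longrightarrow> f (x \<oplus>\<^bsub>H\<^esub> y) = f x + f y"
    and smult: "\<And>a x. x \<in> carrier H \<Longrightarrow> f (a \<odot>\<^bsub>H\<^esub> x) = a * f x"
    and bound: "\<And>x. x \<in> carrier H \<Longrightarrow> cmod (f x) \<le> K * hnorm H x"
  obtains l where "l \<in> carrier H" "\<And>x. x \<in> carrier H \<Longrightarrow> f x = cinner H x l"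
proof -
  define q where "q x = (hnorm H x)\<^sup>2 - 2 * Re (f x)" for x
  have diff: "f (x \<ominus>\<^bsub>H\<^esub> y) = f x - f y" if "x \<in> carrier H" "y \<in> carrier H" for x y
    using that by (simp add: minus_smult add smult)
  have q_add: "q (x \<oplus>\<^bsub>H\<^esub> y) = q x + (hnorm H y)\<^sup>2 + 2 * Re (cinner H y x - f y)"
    if "x \<in> carrier H" "y \<in> carrier H" for x y
    using that cinner_commute[of x y] by (simp add: q_def hnorm_add_sq add)
  have q_mid: "q (mid x y) \<le> (q x + q y) / 2 - 1/4 * (hnorm H (x \<ominus>\<^bsub>H\<^esub> y))\<^sup>2"
    if "x \<in> carrier H" "y \<in> carrier H" for x y
    using that unfolding q_def hnorm_mid_sq[OF that] by (simp add: mid_def add smult field_simps)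
  have bdd: "bdd_below (q ` carrier H)"
  proof (rule bdd_belowI2)
    fix x assume x: "x \<in> carrier H"
    have "Re (f x) \<le> K * hnorm H x" using bound[OF x] complex_Re_le_cmod order_trans by blast
    \<comment> \<open>Completing the square turns the linear bound on \<open>f\<close> into the
      lower bound \<open>- K\<^sup>2\<close>.\<close>
    moreover have "0 \<le> (hnorm H x - K)\<^sup>2" by simp
    ultimately show "- K\<^sup>2 \<le> q x" by (simp add: q_def power2_diff mult.commute)
  qed
  obtain \<sigma> l where \<sigma>: "\<And>n. \<sigma> n \<in> carrier H" and l: "l \<in> carrier H"
    and lim: "(\<lambda>n. hnorm H (\<sigma> n \<ominus>\<^bsub>H\<^esub> l)) \<longlonglongrightarrow> 0"
    and qlim: "(\<lambda>n. q (\<sigma> n)) \<longlonglongrightarrow> (INF x\<in>carrier H. q x)"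
    by (rule minimizing_sequence[OF subset_refl _ mid_closed bdd _ q_mid]) (use M.zero_closed in auto)
  \<comment> \<open>This \<open>q\<close> is continuous, so the limit vector attains the infimum.
    The error is expanded at \<open>l\<close> with \<open>q_add\<close>.\<close>
  have "(\<lambda>n. q (\<sigma> n)) \<longlonglongrightarrow> q l"
  proof (rule Lim_null_comparison[THEN LIM_zero_cancel])
    define B where "B = 2 * (hnorm H l + \<bar>K\<bar>)"
    have "\<bar>q (\<sigma> n) - q l\<bar> \<le> (hnorm H (\<sigma> n \<ominus>\<^bsub>H\<^esub> l))\<^sup>2 + B * hnorm H (\<sigma> n \<ominus>\<^bsub>H\<^esub> l)" for n
    proof -
      define d where "d = \<sigma> n \<ominus>\<^bsub>H\<^esub> l"
      have d: "d \<in> carrier H" using \<sigma> l by (simp add: d_def)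
      have "\<sigma> n = l \<oplus>\<^bsub>H\<^esub> d"
        using add_minus_cancel[OF l \<sigma>] by (simp add: d_def)
      then have eq: "q (\<sigma> n) - q l = (hnorm H d)\<^sup>2 + 2 * Re (cinner H d l - f d)"
        using q_add[OF l d] by simp
      have "\<bar>Re (cinner H d l - f d)\<bar> \<le> cmod (cinner H d l) + cmod (f d)"
        by (meson abs_Re_le_cmod norm_triangle_ineq4 order_trans)
      moreover have "cmod (cinner H d l) \<le> hnorm H d * hnorm H l"
        by (rule Cauchy_Schwarz[OF d l])
      moreover have "cmod (f d) \<le> \<bar>K\<bar> * hnorm H d"
        using bound[OF d] mult_right_mono[OF abs_ge_self hnorm_nonneg[OF d], of K] by linarith
      ultimately have "\<bar>Re (cinner H d l - f d)\<bar> \<le> (hnorm H l + \<bar>K\<bar>) * hnorm H d"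
        by (simp add: ring_distribs mult.commute)
      with eq have "\<bar>q (\<sigma> n) - q l\<bar> \<le> (hnorm H d)\<^sup>2 + 2 * ((hnorm H l + \<bar>K\<bar>) * hnorm H d)"
        using abs_triangle_ineq[of "(hnorm H d)\<^sup>2" "2 * Re (cinner H d l - f d)"] by simp
      then show ?thesis
        by (simp add: B_def d_def algebra_simps)
    qed
    then show "\<forall>\<^sub>F n in sequentially. norm (q (\<sigma> n) - q l) \<le>
        (hnorm H (\<sigma> n \<ominus>\<^bsub>H\<^esub> l))\<^sup>2 + B * hnorm H (\<sigma> n \<ominus>\<^bsub>H\<^esub> l)"
      by simp
    show "(\<lambda>n. (hnorm H (\<sigma> n \<ominus>\<^bsub>H\<^esub> l))\<^sup>2 + B * hnorm H (\<sigma> n \<ominus>\<^bsub>H\<^esub> l)) \<longlonglongrightarrow> 0"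
      by (rule tendsto_eq_intros lim refl | simp)+
  qed
  then have "q l = (INF x\<in>carrier H. q x)"
    using qlim LIMSEQ_unique by blast
  then have min: "q l \<le> q x" if "x \<in> carrier H" for x
    using cINF_lower[OF bdd that] by simp
  have "f x = cinner H x l" if x: "x \<in> carrier H" for x
  proof (rule ccontr)
    \<comment> \<open>A nonzero defect \<open>g\<close> gives a descent direction: moving from
      \<open>l\<close> by \<open>y\<close> changes \<open>q\<close> by
      \<open>t * (cmod g)\<^sup>2 * (t * (hnorm H x)\<^sup>2 - 2)\<close>, which is negative since
      \<open>t * (hnorm H x)\<^sup>2 < 1\<close>.\<close>
    define g where "g = cinner H x l - f x"
    define t where "t = 1 / ((hnorm H x)\<^sup>2 + 1)"
    define y where "y = (- of_real t * cnj g) \<odot>\<^bsub>H\<^esub> x"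
    have pos: "(hnorm H x)\<^sup>2 + 1 > 0" by (rule add_nonneg_pos) auto
    then have t: "t > 0" "t * (hnorm H x)\<^sup>2 < 1"
      by (auto simp: t_def)
    assume "f x \<noteq> cinner H x l"
    then have g: "cmod g > 0" by (auto simp: g_def)
    have "cinner H y l - f y = - of_real t * (cnj g * g)"
      using x l by (simp add: y_def cinner_smult_left smult g_def algebra_simps)
    also have "cnj g * g = of_real ((cmod g)\<^sup>2)"
      by (metis complex_norm_square mult.commute)
    finally have "Re (cinner H y l - f y) = - t * (cmod g)\<^sup>2"
      by (metis Re_complex_of_real of_real_minus of_real_mult)
    moreover have "(hnorm H y)\<^sup>2 = t * (cmod g)\<^sup>2 * (t * (hnorm H x)\<^sup>2)"
      using x t by (simp add: y_def hnorm_smult norm_mult power_mult_distrib power2_eq_square)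
    ultimately have "0 \<le> t * (cmod g)\<^sup>2 * (t * (hnorm H x)\<^sup>2 - 2)"
      using min[of "l \<oplus>\<^bsub>H\<^esub> y"] q_add[OF l, of y] x l by (simp add: y_def algebra_simps)
    moreover have "t * (cmod g)\<^sup>2 > 0" using t g by simp
    ultimately have "0 \<le> t * (hnorm H x)\<^sup>2 - 2" by (metis linorder_not_less mult_pos_neg)
    then show False using t by simp
  qed
  with l show thesis by (rule that)
qed


subsection \<open>Uniformly bounded representations\<close>

lemma (in complex_inner_space) hnorm_minus_triangle:
  assumes "x \<in> carrier H" "y \<in> carrier H" "z \<in> carrier H"
  shows "hnorm H (x \<ominus>\<^bsub>H\<^esub> z) \<le> hnorm H (x \<ominus>\<^bsub>H\<^esub> y) + hnorm H (y \<ominus>\<^bsub>H\<^esub> z)"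
  using metric.triangle[OF assms] assms by (simp add: hdist_def)

text \<open>Reduces continuity into an abstract metric topology to a real limit. The filter
  \<open>nhds s\<close>, unlike the punctured one, composes with translations and inversion without
  side conditions.\<close>

lemma (in complex_inner_space) continuous_map_htopology:
  fixes f :: "'a::topological_space \<Rightarrow> 'h"
  assumes f: "\<And>s. f s \<in> carrier H"
  shows "continuous_map euclidean (htopology H) f \<longleftrightarrow>
    (\<forall>s. ((\<lambda>t. hnorm H (f t \<ominus>\<^bsub>H\<^esub> f s)) \<longlongrightarrow> 0) (nhds s))"
  unfolding metric.continuous_map_to_metric tendsto_iff eventually_nhds
  using f by (simp add: metric.in_mball hdist_def hnorm_minus_commute)

lemma (in complex_inner_space) tendsto_cinner_left:
  assumes f: "\<And>s. f s \<in> carrier H" and l: "l \<in> carrier H" and y: "y \<in> carrier H"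
    and lim: "((\<lambda>s. hnorm H (f s \<ominus>\<^bsub>H\<^esub> l)) \<longlongrightarrow> 0) F"
  shows "((\<lambda>s. cinner H (f s) y) \<longlongrightarrow> cinner H l y) F"
proof (rule Lim_null_comparison[THEN LIM_zero_cancel])
  show "\<forall>\<^sub>F s in F. norm (cinner H (f s) y - cinner H l y) \<le> hnorm H (f s \<ominus>\<^bsub>H\<^esub> l) * hnorm H y"
    using Cauchy_Schwarz[OF M.minus_closed[OF f l] y] f l y by (simp add: cinner_diff_left)
  show "((\<lambda>s. hnorm H (f s \<ominus>\<^bsub>H\<^esub> l) * hnorm H y) \<longlongrightarrow> 0) F"
    using tendsto_mult_right[OF lim, of "hnorm H y"] by simp
qed

text \<open>Continuity is left out so that the adjoint representation is an instance before its
  strong continuity is known. The bound is stated vector by vector, and invertibility follows from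
  \<open>rep_one\<close> and \<open>rep_mult\<close>.\<close>

locale uniformly_bounded_rep = complex_hilbert_space H for H :: "'h inner_module" +
  fixes \<pi> :: "'g::topological_group_add \<Rightarrow> 'h \<Rightarrow> 'h" and c :: real
  assumes rep_closed [simp]: "x \<in> carrier H \<Longrightarrow> \<pi> s x \<in> carrier H"
    and rep_add: "\<lbrakk>x \<in> carrier H; y \<in> carrier H\<rbrakk> \<Longrightarrow> \<pi> s (x \<oplus>\<^bsub>H\<^esub> y) = \<pi> s x \<oplus>\<^bsub>H\<^esub> \<pi> s y"
    and rep_smult: "x \<in> carrier H \<Longrightarrow> \<pi> s (a \<odot>\<^bsub>H\<^esub> x) = a \<odot>\<^bsub>H\<^esub> \<pi> s x"
    and rep_mult: "x \<in> carrier H \<Longrightarrow> \<pi> (s + t) x = \<pi> s (\<pi> t x)"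
    and rep_one: "x \<in> carrier H \<Longrightarrow> \<pi> 0 x = x"
    and rep_bound: "x \<in> carrier H \<Longrightarrow> hnorm H (\<pi> s x) \<le> c * hnorm H x"
    and c_ge_1: "c \<ge> 1"
begin

lemma rep_diff: "\<lbrakk>x \<in> carrier H; y \<in> carrier H\<rbrakk> \<Longrightarrow> \<pi> s (x \<ominus>\<^bsub>H\<^esub> y) = \<pi> s x \<ominus>\<^bsub>H\<^esub> \<pi> s y"
  by (simp add: minus_smult rep_add rep_smult)

lemma rep_mid: "\<lbrakk>x \<in> carrier H; y \<in> carrier H\<rbrakk> \<Longrightarrow> \<pi> s (mid x y) = mid (\<pi> s x) (\<pi> s y)"
  by (simp add: mid_def rep_add rep_smult)

lemma rep_inverse: "x \<in> carrier H \<Longrightarrow> \<pi> (- s) (\<pi> s x) = x" "x \<in> carrier H \<Longrightarrow> \<pi> s (\<pi> (- s) x) = x"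
  by (simp_all add: rep_one flip: rep_mult)

lemma rep_bound_below: "x \<in> carrier H \<Longrightarrow> hnorm H x \<le> c * hnorm H (\<pi> s x)"
  using rep_bound[of "\<pi> s x" "- s"] by (simp add: rep_inverse)

text \<open>The square of an invariant norm equivalent to the Hilbert norm; it is left squared
  because the parallelogram law concerns squares.\<close>

definition orbit_norm2 :: "'h \<Rightarrow> real" where
  "orbit_norm2 x = (SUP s. (hnorm H (\<pi> s x))\<^sup>2)"

lemma bdd_orbit: "x \<in> carrier H \<Longrightarrow> bdd_above (range (\<lambda>s. (hnorm H (\<pi> s x))\<^sup>2))"
  by (rule bdd_aboveI2[where M = "(c * hnorm H x)\<^sup>2"]) (simp add: power_mono rep_bound)

lemma orbit_le_orbit_norm2: "x \<in> carrier H \<Longrightarrow> (hnorm H (\<pi> s x))\<^sup>2 \<le> orbit_norm2 x"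
  unfolding orbit_norm2_def by (rule cSUP_upper[OF UNIV_I bdd_orbit])

lemma orbit_norm2_nonneg: "x \<in> carrier H \<Longrightarrow> 0 \<le> orbit_norm2 x"
  by (rule order_trans[OF zero_le_power2 orbit_le_orbit_norm2])

lemma orbit_norm2_rep: "x \<in> carrier H \<Longrightarrow> orbit_norm2 (\<pi> s x) = orbit_norm2 x"
proof -
  assume x: "x \<in> carrier H"
  have "surj (\<lambda>t. t + s)"
    by (metis diff_add_cancel surj_def)
  then have "range (\<lambda>t. (hnorm H (\<pi> (t + s) x))\<^sup>2) = range (\<lambda>t. (hnorm H (\<pi> t x))\<^sup>2)"
    using image_image[of "\<lambda>t. (hnorm H (\<pi> t x))\<^sup>2" "\<lambda>t. t + s" UNIV] by simp
  then show ?thesis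
    using x by (simp add: orbit_norm2_def rep_mult)
qed

text \<open>The invariant norm \<^term>\<open>sqrt (orbit_norm2 x)\<close> inherits uniform convexity from the Hilbert norm,
  because the parallelogram law can be applied at each \<^term>\<open>\<pi> s\<close> before taking the supremum.\<close>

lemma orbit_norm2_mid:
  assumes x: "x \<in> carrier H" and y: "y \<in> carrier H"
  shows "orbit_norm2 (mid x y) \<le> (orbit_norm2 x + orbit_norm2 y) / 2 - 1 / (4 * c\<^sup>2) * (hnorm H (x \<ominus>\<^bsub>H\<^esub> y))\<^sup>2"
  unfolding orbit_norm2_def[of "mid x y"]
proof (rule cSUP_least)
  fix s :: 'g
  \<comment> \<open>The lower bound for \<open>\<pi> s\<close> replaces the parallelogram deficit at
    \<open>s\<close> by one independent of \<open>s\<close>, at the cost of the factor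
    \<open>c\<^sup>2\<close>; this survives the supremum.\<close>
  have "(hnorm H (x \<ominus>\<^bsub>H\<^esub> y))\<^sup>2 \<le> (c * hnorm H (\<pi> s (x \<ominus>\<^bsub>H\<^esub> y)))\<^sup>2"
    by (intro power_mono rep_bound_below) (use x y in auto)
  then have "1 / (4 * c\<^sup>2) * (hnorm H (x \<ominus>\<^bsub>H\<^esub> y))\<^sup>2 \<le> (hnorm H (\<pi> s x \<ominus>\<^bsub>H\<^esub> \<pi> s y))\<^sup>2 / 4"
    using c_ge_1 x y by (simp add: rep_diff power_mult_distrib field_simps)
  then show "(hnorm H (\<pi> s (mid x y)))\<^sup>2 \<le>
      (orbit_norm2 x + orbit_norm2 y) / 2 - 1 / (4 * c\<^sup>2) * (hnorm H (x \<ominus>\<^bsub>H\<^esub> y))\<^sup>2"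
    using orbit_le_orbit_norm2[OF x, of s] orbit_le_orbit_norm2[OF y, of s]
    unfolding rep_mid[OF x y] hnorm_mid_sq[OF rep_closed[OF x] rep_closed[OF y]]
    by (intro diff_mono) auto
qed simp

text \<open>A vector and its translate have the same \<open>orbit_norm2\<close>, so along a
  minimizing sequence their distance tends to 0 and the limit is fixed. The sequence is part of the
  conclusion because the averages of a coefficient are read off from it.\<close>

lemma fixed_vector:
  assumes S: "S \<subseteq> carrier H" "S \<noteq> {}" and mid: "\<And>x y. \<lbrakk>x \<in> S; y \<in> S\<rbrakk> \<Longrightarrow> mid x y \<in> S"
    and inv: "\<And>s x. x \<in> S \<Longrightarrow> \<pi> s x \<in> S"
  obtains \<sigma> l where "\<And>n. \<sigma> n \<in> S" "l \<in> carrier H"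
    "(\<lambda>n. hnorm H (\<sigma> n \<ominus>\<^bsub>H\<^esub> l)) \<longlonglongrightarrow> 0" "\<And>s. \<pi> s l = l"
proof -
  define \<kappa> where "\<kappa> = 1 / (4 * c\<^sup>2)"
  define I where "I = (INF x\<in>S. orbit_norm2 x)"
  have \<kappa>: "\<kappa> > 0" using c_ge_1 by (simp add: \<kappa>_def)
  have conv: "orbit_norm2 (mid x y) \<le> (orbit_norm2 x + orbit_norm2 y) / 2 - \<kappa> * (hnorm H (x \<ominus>\<^bsub>H\<^esub> y))\<^sup>2"
    if "x \<in> S" "y \<in> S" for x y
    unfolding \<kappa>_def by (rule orbit_norm2_mid) (use that S in auto)
  have bdd: "bdd_below (orbit_norm2 ` S)"
    using S orbit_norm2_nonneg by (auto intro!: bdd_belowI2[where m = 0])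
  obtain \<sigma> l where \<sigma>: "\<And>n. \<sigma> n \<in> S" and l: "l \<in> carrier H"
    and lim: "(\<lambda>n. hnorm H (\<sigma> n \<ominus>\<^bsub>H\<^esub> l)) \<longlonglongrightarrow> 0" and norm2_lim: "(\<lambda>n. orbit_norm2 (\<sigma> n)) \<longlonglongrightarrow> I"
    unfolding I_def by (rule minimizing_sequence[OF S mid bdd \<kappa> conv]) auto
  have \<sigma>H: "\<sigma> n \<in> carrier H" for n using \<sigma> S by blast
  have "\<pi> s l = l" for s
  proof -
    \<comment> \<open>In the midpoint inequality for \<open>\<sigma> n\<close> and
      \<open>\<pi> s (\<sigma> n)\<close> the two values average to
      \<open>orbit_norm2 (\<sigma> n)\<close>, while the midpoint stays in \<open>S\<close>.\<close>
    have "\<kappa> * (hnorm H (\<sigma> n \<ominus>\<^bsub>H\<^esub> \<pi> s (\<sigma> n)))\<^sup>2 \<le> orbit_norm2 (\<sigma> n) - I" for n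
    proof -
      have "I \<le> orbit_norm2 (mid (\<sigma> n) (\<pi> s (\<sigma> n)))"
        unfolding I_def by (rule cINF_lower[OF bdd mid[OF \<sigma> inv[OF \<sigma>]]])
      then show ?thesis
        using conv[OF \<sigma>[of n] inv[OF \<sigma>[of n], of s]] orbit_norm2_rep[OF \<sigma>H[of n], of s] by simp
    qed
    then have est: "hnorm H (\<sigma> n \<ominus>\<^bsub>H\<^esub> \<pi> s (\<sigma> n)) \<le> sqrt ((orbit_norm2 (\<sigma> n) - I) / \<kappa>)" for n
      using \<kappa> by (intro real_le_rsqrt) (simp add: field_simps)
    \<comment> \<open>The path from \<open>\<pi> s l\<close> to \<open>l\<close> goes through
      \<open>\<pi> s (\<sigma> n)\<close> and \<open>\<sigma> n\<close>; its outer pieces give the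
      factors \<open>c\<close> and \<open>1\<close>.\<close>
    have le: "hnorm H (\<pi> s l \<ominus>\<^bsub>H\<^esub> l) \<le>
        (c + 1) * hnorm H (\<sigma> n \<ominus>\<^bsub>H\<^esub> l) + sqrt ((orbit_norm2 (\<sigma> n) - I) / \<kappa>)" for n
    proof -
      let ?x = "\<sigma> n"
      have x: "?x \<in> carrier H" by (rule \<sigma>H)
      have "hnorm H (\<pi> s l \<ominus>\<^bsub>H\<^esub> l) \<le> hnorm H (\<pi> s l \<ominus>\<^bsub>H\<^esub> \<pi> s ?x) + hnorm H (\<pi> s ?x \<ominus>\<^bsub>H\<^esub> l)"
        by (rule hnorm_minus_triangle) (use x l in auto)
      moreover have "hnorm H (\<pi> s ?x \<ominus>\<^bsub>H\<^esub> l) \<le> hnorm H (\<pi> s ?x \<ominus>\<^bsub>H\<^esub> ?x) + hnorm H (?x \<ominus>\<^bsub>H\<^esub> l)"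
        by (rule hnorm_minus_triangle) (use x l in auto)
      moreover have "hnorm H (\<pi> s l \<ominus>\<^bsub>H\<^esub> \<pi> s ?x) \<le> c * hnorm H (?x \<ominus>\<^bsub>H\<^esub> l)"
        using rep_bound[of "l \<ominus>\<^bsub>H\<^esub> ?x" s] x l by (simp add: rep_diff hnorm_minus_commute)
      moreover have "hnorm H (\<pi> s ?x \<ominus>\<^bsub>H\<^esub> ?x) \<le> sqrt ((orbit_norm2 ?x - I) / \<kappa>)"
        using est[of n] x by (simp add: hnorm_minus_commute)
      ultimately show ?thesis by (simp add: algebra_simps)
    qed
    have "(\<lambda>n. (c + 1) * hnorm H (\<sigma> n \<ominus>\<^bsub>H\<^esub> l) + sqrt ((orbit_norm2 (\<sigma> n) - I) / \<kappa>)) \<longlonglongrightarrow>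
        (c + 1) * 0 + sqrt ((I - I) / \<kappa>)"
      using \<kappa> by (intro tendsto_intros lim norm2_lim) auto
    then have "hnorm H (\<pi> s l \<ominus>\<^bsub>H\<^esub> l) \<le> 0"
      using le by (intro LIMSEQ_le_const) auto
    then have "hnorm H (\<pi> s l \<ominus>\<^bsub>H\<^esub> l) = 0"
      using l by (intro antisym) auto
    then show ?thesis
      using l by (simp add: hnorm_eq_0 minus_eq_zero)
  qed
  with \<sigma> l lim show thesis by (rule that)
qed

text \<open>Weak convergence \<open>\<pi> s x \<rightarrow> x\<close> together with the constancy of the uniformly convex norm
  \<^const>\<open>orbit_norm2\<close> on the orbit forces norm convergence.\<close>

lemma strongly_continuous_if_weakly_continuous:
  assumes weak: "\<And>x y s. \<lbrakk>x \<in> carrier H; y \<in> carrier H\<rbrakk> \<Longrightarrow>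
      ((\<lambda>s. cinner H (\<pi> s x) y) \<longlongrightarrow> cinner H (\<pi> s x) y) (nhds s)"
    and x: "x \<in> carrier H"
  shows "continuous_map euclidean (htopology H) (\<lambda>s. \<pi> s x)"
proof -
  have at_0: "((\<lambda>s. hnorm H (\<pi> s x \<ominus>\<^bsub>H\<^esub> x)) \<longlongrightarrow> 0) (nhds 0)"
    unfolding tendsto_iff
  proof (intro allI impI)
    fix e :: real assume e: "e > 0"
    \<comment> \<open>With this \<open>d\<close>, a deficit of \<open>2 * d\<close> in the midpoint
      inequality corresponds to the squared distance \<open>e\<^sup>2\<close>.\<close>
    define d where "d = e\<^sup>2 / (8 * c\<^sup>2)"
    have d: "d > 0" using e c_ge_1 by (simp add: d_def)
    \<comment> \<open>The supremum is nearly attained at some \<open>t\<close>; weak continuity is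
      then tested against the vector \<open>\<pi> t x\<close>.\<close>
    have "\<exists>t. orbit_norm2 x - d < (hnorm H (\<pi> t x))\<^sup>2"
      using less_cSUP_iff[OF _ bdd_orbit[OF x], of "orbit_norm2 x - d"] d by (simp add: orbit_norm2_def)
    then obtain t where t: "orbit_norm2 x - d < (hnorm H (\<pi> t x))\<^sup>2" ..
    define u where "u = \<pi> t x"
    have u: "u \<in> carrier H" using x by (simp add: u_def)
    have "filterlim (\<lambda>s. t + s) (nhds t) (nhds 0)"
      using tendsto_add[OF tendsto_const filterlim_ident, of t 0] by simp
    from filterlim_compose[OF weak[OF x u] this]
    have "((\<lambda>s. Re (cinner H (\<pi> (t + s) x) u)) \<longlongrightarrow> Re (cinner H u u)) (nhds 0)"
      unfolding u_def by (rule tendsto_Re)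
    moreover have "Re (cinner H u u) = (hnorm H u)\<^sup>2"
      using cinner_self[OF u] by simp
    ultimately have "\<forall>\<^sub>F s in nhds 0. (hnorm H u)\<^sup>2 - d < Re (cinner H (\<pi> (t + s) x) u)"
      using d by (intro order_tendstoD(1)) auto
    then show "\<forall>\<^sub>F s in nhds 0. dist (hnorm H (\<pi> s x \<ominus>\<^bsub>H\<^esub> x)) 0 < e"
    proof eventually_elim
      fix s assume s: "(hnorm H u)\<^sup>2 - d < Re (cinner H (\<pi> (t + s) x) u)"
      let ?y = "mid (\<pi> s x) x"
      have y: "?y \<in> carrier H" using x by simp
      \<comment> \<open>Expanding this square bounds \<open>(hnorm H (\<pi> t ?y))\<^sup>2\<close>
        below by an expression affine in \<open>?y\<close>, which weak continuity controls.\<close>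
      have "0 \<le> (hnorm H (\<pi> t ?y \<ominus>\<^bsub>H\<^esub> u))\<^sup>2" by simp
      then have "2 * Re (cinner H (\<pi> t ?y) u) - (hnorm H u)\<^sup>2 \<le> (hnorm H (\<pi> t ?y))\<^sup>2"
        using x u by (simp add: hnorm_diff_sq)
      also have "\<dots> \<le> orbit_norm2 ?y" by (rule orbit_le_orbit_norm2[OF y])
      also have "\<dots> \<le> orbit_norm2 x - 1 / (4 * c\<^sup>2) * (hnorm H (\<pi> s x \<ominus>\<^bsub>H\<^esub> x))\<^sup>2"
        using orbit_norm2_mid[of "\<pi> s x" x] x by (simp add: orbit_norm2_rep)
      also have "2 * Re (cinner H (\<pi> t ?y) u) = Re (cinner H (\<pi> (t + s) x) u) + (hnorm H u)\<^sup>2"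
        using x u cinner_self[OF u] by (simp add: rep_mid cinner_mid_left rep_mult u_def)
      finally have "1 / (4 * c\<^sup>2) * (hnorm H (\<pi> s x \<ominus>\<^bsub>H\<^esub> x))\<^sup>2 < 2 * d"
        using s t by (simp add: u_def)
      then have "(hnorm H (\<pi> s x \<ominus>\<^bsub>H\<^esub> x))\<^sup>2 < e\<^sup>2"
        using c_ge_1 by (simp add: d_def field_simps)
      then show "dist (hnorm H (\<pi> s x \<ominus>\<^bsub>H\<^esub> x)) 0 < e"
        using e x by (simp add: power_less_imp_less_base)
    qed
  qed
  show ?thesis
  proof (subst continuous_map_htopology, simp add: x, rule allI)
    fix s :: 'g
    \<comment> \<open>Continuity at \<open>s\<close> is transported from 0: the difference of
      \<open>\<pi> t x\<close> and \<open>\<pi> s x\<close> is the image under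
      \<open>\<pi> s\<close> of that of \<open>\<pi> (- s + t) x\<close> and
      \<open>x\<close>.\<close>
    have lim: "filterlim (\<lambda>t. - s + t) (nhds 0) (nhds s)"
      using tendsto_add[OF tendsto_const filterlim_ident, of "- s" s] by simp
    show "((\<lambda>t. hnorm H (\<pi> t x \<ominus>\<^bsub>H\<^esub> \<pi> s x)) \<longlongrightarrow> 0) (nhds s)"
    proof (rule Lim_null_comparison)
      have "\<pi> t x \<ominus>\<^bsub>H\<^esub> \<pi> s x = \<pi> s (\<pi> (- s + t) x \<ominus>\<^bsub>H\<^esub> x)" for t
        using x by (simp add: rep_diff rep_mult rep_inverse)
      then show "\<forall>\<^sub>F t in nhds s. norm (hnorm H (\<pi> t x \<ominus>\<^bsub>H\<^esub> \<pi> s x)) \<le>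
          c * hnorm H (\<pi> (- s + t) x \<ominus>\<^bsub>H\<^esub> x)"
        using rep_bound x by simp
      show "((\<lambda>t. c * hnorm H (\<pi> (- s + t) x \<ominus>\<^bsub>H\<^esub> x)) \<longlongrightarrow> 0) (nhds s)"
        using tendsto_mult_left[OF filterlim_compose[OF at_0 lim], of c] by simp
    qed
  qed
qed

lemma bounded_representationI:
  assumes "\<And>x. x \<in> carrier H \<Longrightarrow> continuous_map euclidean (htopology H) (\<lambda>s. \<pi> s x)"
  shows "bounded_representation c H \<pi>"
proof -
  have "bounded_operator H (\<pi> s)" for s
    unfolding bounded_operator_def using rep_add rep_smult rep_bound
    by (intro conjI exI[of _ c]) auto
  then have "invertible_operator H (\<pi> s)" for s
    unfolding invertible_operator_def using rep_inverse by blast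
  moreover have "op_norm H (\<pi> s) \<le> c" for s
    by (rule op_norm_leI) (use c_ge_1 rep_bound complex_hilbert_space_axioms in auto)
  ultimately show ?thesis
    unfolding bounded_representation_def using assms rep_mult by blast
qed

end

lemma uniformly_bounded_rep_if_bounded_representation:
  assumes H: "complex_hilbert_space H" and rep: "bounded_representation c H \<pi>" and c: "c \<ge> 1"
  shows "uniformly_bounded_rep H \<pi> c"
proof -
  interpret complex_hilbert_space H by (rule H)
  have inv: "invertible_operator H (\<pi> s)" and bnd: "bounded_operator H (\<pi> s)"
    and op: "op_norm H (\<pi> s) \<le> c"
    and mult: "x \<in> carrier H \<Longrightarrow> \<pi> (s + t) x = \<pi> s (\<pi> t x)" for s t x
    using rep by (auto simp: bounded_representation_def invertible_operator_def)
  show ?thesis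
  proof
    show closed: "\<pi> s x \<in> carrier H" if "x \<in> carrier H" for s x
      using bnd[of s] that by (auto simp: bounded_operator_def)
    \<comment> \<open>\<open>\<pi> 0\<close> is idempotent and has a left inverse on the carrier,
      hence is the identity there.\<close>
    show "\<pi> 0 x = x" if x: "x \<in> carrier H" for x
      using inv[of 0] mult[OF x, of 0 0] x closed unfolding invertible_operator_def
      by (metis add_0)
    show "hnorm H (\<pi> s x) \<le> c * hnorm H x" if "x \<in> carrier H" for s x
      using op_norm_bound(1)[OF H bnd that, of s] op[of s] that
      by (meson hnorm_nonneg mult_right_mono order_trans)
  qed (use bnd mult c in \<open>auto simp: bounded_operator_def\<close>)
qed


subsection \<open>Conjugate spaces, orthogonal sums and the complex line\<close>

lemma (in complex_inner_space) cinner_diff_right: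
  "\<lbrakk>x \<in> carrier H; y \<in> carrier H; z \<in> carrier H\<rbrakk> \<Longrightarrow>
    cinner H z (x \<ominus>\<^bsub>H\<^esub> y) = cinner H z x - cinner H z y"
  by (simp add: minus_smult cinner_add_right cinner_smult_right)

lemma (in complex_inner_space) eq_if_cinner_eq:
  assumes "x \<in> carrier H" "y \<in> carrier H"
    and "\<And>z. z \<in> carrier H \<Longrightarrow> cinner H z x = cinner H z y"
  shows "x = y"
  using assms cinner_definite[of "x \<ominus>\<^bsub>H\<^esub> y"] by (simp add: cinner_diff_right minus_eq_zero)

lemma (in complex_inner_space) complex_hilbert_spaceI:
  assumes complete: "\<And>\<sigma>. \<lbrakk>\<And>n. \<sigma> n \<in> carrier H;
      \<And>e. e > 0 \<Longrightarrow> \<exists>N. \<forall>m\<ge>N. \<forall>n\<ge>N. hnorm H (\<sigma> m \<ominus>\<^bsub>H\<^esub> \<sigma> n) < e\<rbrakk> \<Longrightarrow>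
      \<exists>l\<in>carrier H. (\<lambda>n. hnorm H (\<sigma> n \<ominus>\<^bsub>H\<^esub> l)) \<longlonglongrightarrow> 0"
  shows "complex_hilbert_space H"
proof
  show "metric.mcomplete"
    unfolding metric.mcomplete_def
  proof (intro allI impI)
    fix \<sigma> assume \<sigma>: "metric.MCauchy \<sigma>"
    then have ran: "\<And>n. \<sigma> n \<in> carrier H" by (auto simp: metric.MCauchy_def)
    then obtain l where "l \<in> carrier H" "(\<lambda>n. hnorm H (\<sigma> n \<ominus>\<^bsub>H\<^esub> l)) \<longlonglongrightarrow> 0"
      using complete[of \<sigma>] \<sigma> by (auto simp: metric.MCauchy_def hdist_def)
    then show "\<exists>l. limitin (htopology H) \<sigma> l sequentially"
      using ran by (intro exI[of _ l])
        (simp add: metric.limit_metric_sequentially hdist_def LIMSEQ_iff)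
  qed
qed


text \<open>The same operators acting on the conjugate space have conjugated coefficients. Norm and
  metric are those of \<open>H\<close>, so completeness is inherited.\<close>

definition conj_space :: "'h inner_module \<Rightarrow> 'h inner_module" where
  "conj_space H = H\<lparr>smult := \<lambda>a. smult H (cnj a), cinner := \<lambda>x y. cinner H y x\<rparr>"

lemma conj_space_simps [simp]:
  "carrier (conj_space H) = carrier H" "\<zero>\<^bsub>conj_space H\<^esub> = \<zero>\<^bsub>H\<^esub>" "add (conj_space H) = add H"
  "a \<odot>\<^bsub>conj_space H\<^esub> x = cnj a \<odot>\<^bsub>H\<^esub> x" "cinner (conj_space H) x y = cinner H y x"
  by (simp_all add: conj_space_def)

lemma conj_space_minus [simp]: "x \<ominus>\<^bsub>conj_space H\<^esub> y = x \<ominus>\<^bsub>H\<^esub> y"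
  by (simp add: a_minus_def a_inv_def)

lemma hnorm_conj_space [simp]: "hnorm (conj_space H) = hnorm H"
  by (simp add: hnorm_def fun_eq_iff)

lemma hdist_conj_space [simp]: "hdist (conj_space H) = hdist H"
  by (simp add: hdist_def fun_eq_iff)

lemma (in complex_hilbert_space) complex_hilbert_space_conj_space:
  "complex_hilbert_space (conj_space H)"
proof -
  have "abelian_group (conj_space H)"
    using M.abelian_group_axioms
    by (simp add: abelian_group_def abelian_group_axioms_def abelian_monoid_def)
  then have "Module.module complex_ring (conj_space H)"
    by (rule moduleI[OF cring_complex_ring]) (simp_all add: smult_rules)
  then have "complex_inner_space (conj_space H)"
    by (rule complex_inner_space.intro[OF _ complex_inner_space_axioms.intro])
      (auto simp: cinner_add_right cinner_smult_right cinner_commute[symmetric]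
        cinner_nonneg cinner_definite)
  then show ?thesis
    by (rule complex_hilbert_space.intro)
      (simp add: complex_hilbert_space_axioms_def complete)
qed

lemma (in uniformly_bounded_rep) uniformly_bounded_rep_conj_space:
  "uniformly_bounded_rep (conj_space H) \<pi> c"
  using complex_hilbert_space_conj_space
  by (rule uniformly_bounded_rep.intro)
    (unfold_locales, simp_all add: rep_add rep_smult rep_mult rep_one rep_bound c_ge_1)


text \<open>Coefficients add under orthogonal sums. Since squares of norms add, two representations
  bounded by \<open>c\<close> combine to one bounded by the same \<open>c\<close>.\<close>

definition orthogonal_sum :: "'h inner_module \<Rightarrow> 'k inner_module \<Rightarrow> ('h \<times> 'k) inner_module" where
  "orthogonal_sum H K = \<lparr>carrier = carrier H \<times> carrier K, mult = (\<lambda>u v. u), one = (\<zero>\<^bsub>H\<^esub>, \<zero>\<^bsub>K\<^esub>),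
    zero = (\<zero>\<^bsub>H\<^esub>, \<zero>\<^bsub>K\<^esub>), add = (\<lambda>u v. (fst u \<oplus>\<^bsub>H\<^esub> fst v, snd u \<oplus>\<^bsub>K\<^esub> snd v)),
    smult = (\<lambda>a u. (a \<odot>\<^bsub>H\<^esub> fst u, a \<odot>\<^bsub>K\<^esub> snd u)),
    cinner = (\<lambda>u v. cinner H (fst u) (fst v) + cinner K (snd u) (snd v))\<rparr>"

lemma orthogonal_sum_simps [simp]:
  "carrier (orthogonal_sum H K) = carrier H \<times> carrier K"
  "\<zero>\<^bsub>orthogonal_sum H K\<^esub> = (\<zero>\<^bsub>H\<^esub>, \<zero>\<^bsub>K\<^esub>)"
  "u \<oplus>\<^bsub>orthogonal_sum H K\<^esub> v = (fst u \<oplus>\<^bsub>H\<^esub> fst v, snd u \<oplus>\<^bsub>K\<^esub> snd v)"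
  "a \<odot>\<^bsub>orthogonal_sum H K\<^esub> u = (a \<odot>\<^bsub>H\<^esub> fst u, a \<odot>\<^bsub>K\<^esub> snd u)"
  "cinner (orthogonal_sum H K) u v = cinner H (fst u) (fst v) + cinner K (snd u) (snd v)"
  by (simp_all add: orthogonal_sum_def)

locale two_hilbert_spaces = H: complex_hilbert_space H + K: complex_hilbert_space K
  for H :: "'h inner_module" and K :: "'k inner_module"
begin

lemma complex_inner_space_orthogonal_sum: "complex_inner_space (orthogonal_sum H K)"
proof -
  have "abelian_group (orthogonal_sum H K)"
  proof (rule abelian_groupI)
    show "\<exists>v\<in>carrier (orthogonal_sum H K).
        v \<oplus>\<^bsub>orthogonal_sum H K\<^esub> u = \<zero>\<^bsub>orthogonal_sum H K\<^esub>"
      if "u \<in> carrier (orthogonal_sum H K)" for u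
      using that by (intro bexI[of _ "(\<ominus>\<^bsub>H\<^esub> fst u, \<ominus>\<^bsub>K\<^esub> snd u)"])
        (auto simp: H.M.l_neg K.M.l_neg)
  qed (auto simp: H.M.a_ac K.M.a_ac)
  then have "Module.module complex_ring (orthogonal_sum H K)"
    by (rule moduleI[OF cring_complex_ring]) (auto simp: H.smult_rules K.smult_rules)
  then show ?thesis
  proof (rule complex_inner_space.intro[OF _ complex_inner_space_axioms.intro])
    show "cinner (orthogonal_sum H K) u v = cnj (cinner (orthogonal_sum H K) v u)"
      if "u \<in> carrier (orthogonal_sum H K)" "v \<in> carrier (orthogonal_sum H K)" for u v
      using that H.cinner_commute[of "fst u" "fst v"] K.cinner_commute[of "snd u" "snd v"] by auto
    show "cinner (orthogonal_sum H K) u u \<in> \<real>\<^sub>\<ge>\<^sub>0" if "u \<in> carrier (orthogonal_sum H K)" for u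
      using that H.cinner_nonneg[of "fst u"] K.cinner_nonneg[of "snd u"] by auto
    show "u = \<zero>\<^bsub>orthogonal_sum H K\<^esub>"
      if u: "u \<in> carrier (orthogonal_sum H K)" and 0: "cinner (orthogonal_sum H K) u u = 0" for u
    proof -
      have "of_real ((hnorm H (fst u))\<^sup>2 + (hnorm K (snd u))\<^sup>2) = (0 :: complex)"
        using u 0 H.cinner_self[of "fst u"] K.cinner_self[of "snd u"] by auto
      then have "(hnorm H (fst u))\<^sup>2 + (hnorm K (snd u))\<^sup>2 = 0"
        by (simp only: of_real_eq_0_iff)
      then have "hnorm H (fst u) = 0" "hnorm K (snd u) = 0"
        by (simp_all add: sum_power2_eq_zero_iff)
      then show ?thesis
        using u by (auto simp: H.hnorm_eq_0 K.hnorm_eq_0)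
    qed
  qed (auto simp: H.cinner_add_left K.cinner_add_left H.cinner_smult_left K.cinner_smult_left
      algebra_simps)
qed

sublocale sum: complex_inner_space "orthogonal_sum H K"
  by (rule complex_inner_space_orthogonal_sum)

lemma hnorm_orthogonal_sum:
  assumes "u \<in> carrier (orthogonal_sum H K)"
  shows "hnorm (orthogonal_sum H K) u = sqrt ((hnorm H (fst u))\<^sup>2 + (hnorm K (snd u))\<^sup>2)"
proof -
  have "Re (cinner H (fst u) (fst u)) = (hnorm H (fst u))\<^sup>2"
    "Re (cinner K (snd u) (snd u)) = (hnorm K (snd u))\<^sup>2"
    using assms H.cinner_self[of "fst u"] K.cinner_self[of "snd u"] by auto
  then show ?thesis by (simp add: hnorm_def[of "orthogonal_sum H K"])
qed

lemma hnorm_fst_snd_le: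
  assumes "u \<in> carrier (orthogonal_sum H K)"
  shows "hnorm H (fst u) \<le> hnorm (orthogonal_sum H K) u"
    and "hnorm K (snd u) \<le> hnorm (orthogonal_sum H K) u"
  using hnorm_orthogonal_sum[OF assms] by simp_all

lemma minus_orthogonal_sum:
  assumes "u \<in> carrier (orthogonal_sum H K)" "v \<in> carrier (orthogonal_sum H K)"
  shows "u \<ominus>\<^bsub>orthogonal_sum H K\<^esub> v = (fst u \<ominus>\<^bsub>H\<^esub> fst v, snd u \<ominus>\<^bsub>K\<^esub> snd v)"
  using assms by (auto simp: sum.minus_smult H.minus_smult K.minus_smult)

lemma tendsto_hnorm_orthogonal_sum:
  assumes "\<And>i. f i \<in> carrier (orthogonal_sum H K)" "l \<in> carrier (orthogonal_sum H K)"
    and "((\<lambda>i. hnorm H (fst (f i) \<ominus>\<^bsub>H\<^esub> fst l)) \<longlongrightarrow> 0) F"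
    and "((\<lambda>i. hnorm K (snd (f i) \<ominus>\<^bsub>K\<^esub> snd l)) \<longlongrightarrow> 0) F"
  shows "((\<lambda>i. hnorm (orthogonal_sum H K) (f i \<ominus>\<^bsub>orthogonal_sum H K\<^esub> l)) \<longlongrightarrow> 0) F"
proof -
  have "hnorm (orthogonal_sum H K) (f i \<ominus>\<^bsub>orthogonal_sum H K\<^esub> l) =
      sqrt ((hnorm H (fst (f i) \<ominus>\<^bsub>H\<^esub> fst l))\<^sup>2 + (hnorm K (snd (f i) \<ominus>\<^bsub>K\<^esub> snd l))\<^sup>2)" for i
    unfolding hnorm_orthogonal_sum[OF sum.M.minus_closed[OF assms(1,2)]]
    by (simp only: minus_orthogonal_sum[OF assms(1,2)] fst_conv snd_conv)
  then show ?thesis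
    by (simp only:) (rule tendsto_eq_intros assms refl | simp)+
qed

lemma complex_hilbert_space_orthogonal_sum: "complex_hilbert_space (orthogonal_sum H K)"
proof (rule sum.complex_hilbert_spaceI)
  fix \<sigma> :: "nat \<Rightarrow> 'h \<times> 'k"
  assume \<sigma>: "\<And>n. \<sigma> n \<in> carrier (orthogonal_sum H K)"
    and C: "\<And>e. e > 0 \<Longrightarrow> \<exists>N. \<forall>m\<ge>N. \<forall>n\<ge>N.
      hnorm (orthogonal_sum H K) (\<sigma> m \<ominus>\<^bsub>orthogonal_sum H K\<^esub> \<sigma> n) < e"
  have \<sigma>HK: "fst (\<sigma> n) \<in> carrier H" "snd (\<sigma> n) \<in> carrier K" for n
    using \<sigma>[of n] by auto
  have le: "hnorm H (fst (\<sigma> m) \<ominus>\<^bsub>H\<^esub> fst (\<sigma> n)) \<le>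
      hnorm (orthogonal_sum H K) (\<sigma> m \<ominus>\<^bsub>orthogonal_sum H K\<^esub> \<sigma> n)"
    "hnorm K (snd (\<sigma> m) \<ominus>\<^bsub>K\<^esub> snd (\<sigma> n)) \<le>
      hnorm (orthogonal_sum H K) (\<sigma> m \<ominus>\<^bsub>orthogonal_sum H K\<^esub> \<sigma> n)" for m n
    using hnorm_fst_snd_le[OF sum.M.minus_closed[OF \<sigma> \<sigma>]]
    by (simp_all only: minus_orthogonal_sum[OF \<sigma> \<sigma>] fst_conv snd_conv)
  obtain a where a: "a \<in> carrier H" "(\<lambda>n. hnorm H (fst (\<sigma> n) \<ominus>\<^bsub>H\<^esub> a)) \<longlonglongrightarrow> 0"
    by (rule H.Cauchy_limit[of "\<lambda>n. fst (\<sigma> n)", OF \<sigma>HK(1)])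
      (meson C le(1) le_less_trans)
  obtain b where b: "b \<in> carrier K" "(\<lambda>n. hnorm K (snd (\<sigma> n) \<ominus>\<^bsub>K\<^esub> b)) \<longlonglongrightarrow> 0"
    by (rule K.Cauchy_limit[of "\<lambda>n. snd (\<sigma> n)", OF \<sigma>HK(2)])
      (meson C le(2) le_less_trans)
  show "\<exists>l\<in>carrier (orthogonal_sum H K).
      (\<lambda>n. hnorm (orthogonal_sum H K) (\<sigma> n \<ominus>\<^bsub>orthogonal_sum H K\<^esub> l)) \<longlonglongrightarrow> 0"
    by (rule bexI[of _ "(a, b)"], rule tendsto_hnorm_orthogonal_sum) (use \<sigma> a b in auto)
qed

end

text \<open>The space of the trivial representation, whose coefficients are the constants.\<close>

definition complex_line :: "complex inner_module" where
  "complex_line = \<lparr>carrier = UNIV, mult = (*), one = 1, zero = 0, add = (+), smult = (*),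
    cinner = (\<lambda>x y. x * cnj y)\<rparr>"

lemma complex_line_simps [simp]:
  "carrier complex_line = UNIV" "\<zero>\<^bsub>complex_line\<^esub> = 0" "x \<oplus>\<^bsub>complex_line\<^esub> y = x + y"
  "a \<odot>\<^bsub>complex_line\<^esub> x = a * x" "cinner complex_line x y = x * cnj y"
  by (simp_all add: complex_line_def)

lemma complex_hilbert_space_complex_line: "complex_hilbert_space complex_line"
proof -
  have "abelian_group complex_line"
  proof (rule abelian_groupI)
    show "\<exists>y\<in>carrier complex_line. y \<oplus>\<^bsub>complex_line\<^esub> x = \<zero>\<^bsub>complex_line\<^esub>" for x
      by (rule bexI[of _ "- x"]) auto
  qed auto
  then have "Module.module complex_ring complex_line"
    by (rule moduleI[OF cring_complex_ring]) (simp_all add: algebra_simps)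
  then have "complex_inner_space complex_line"
    by (rule complex_inner_space.intro[OF _ complex_inner_space_axioms.intro])
      (simp_all add: algebra_simps flip: complex_norm_square of_real_power)
  then interpret complex_inner_space complex_line .
  have norm: "hnorm complex_line x = cmod x" for x
    by (simp add: hnorm_def flip: complex_norm_square of_real_power)
  show ?thesis
  proof (rule complex_hilbert_spaceI)
    fix \<sigma> :: "nat \<Rightarrow> complex"
    assume "\<And>e. e > 0 \<Longrightarrow> \<exists>N. \<forall>m\<ge>N. \<forall>n\<ge>N. hnorm complex_line (\<sigma> m \<ominus>\<^bsub>complex_line\<^esub> \<sigma> n) < e"
    then have "Cauchy \<sigma>"
      by (simp add: Cauchy_iff norm minus_smult)
    then obtain l where "\<sigma> \<longlonglongrightarrow> l"
      using Cauchy_convergent_iff convergent_def by blast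
    then show "\<exists>l\<in>carrier complex_line. (\<lambda>n. hnorm complex_line (\<sigma> n \<ominus>\<^bsub>complex_line\<^esub> l)) \<longlonglongrightarrow> 0"
      by (auto simp: norm minus_smult tendsto_norm_zero_iff LIM_zero_iff)
  qed
qed


subsection \<open>The adjoint representation\<close>

context uniformly_bounded_rep
begin

lemma adjoint_exists:
  assumes y: "y \<in> carrier H"
  shows "\<exists>z\<in>carrier H. \<forall>x\<in>carrier H. cinner H (\<pi> s x) y = cinner H x z"
proof -
  obtain z where "z \<in> carrier H" "\<And>x. x \<in> carrier H \<Longrightarrow> cinner H (\<pi> s x) y = cinner H x z"
  proof (rule Riesz_representation[of "\<lambda>x. cinner H (\<pi> s x) y" "c * hnorm H y"])
    show "cmod (cinner H (\<pi> s x) y) \<le> c * hnorm H y * hnorm H x" if "x \<in> carrier H" for x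
      using Cauchy_Schwarz[OF rep_closed[OF that] y, of s]
        mult_right_mono[OF rep_bound[OF that, of s] hnorm_nonneg[OF y]]
      by (simp add: mult_ac)
  qed (use y in \<open>auto simp: rep_add rep_smult cinner_add_left cinner_smult_left\<close>)
  then show ?thesis by blast
qed

text \<open>The inverse \<open>- s\<close> makes the family a homomorphism, since adjoints reverse
  products. The choice is unique because inner products separate vectors.\<close>

definition adjoint_rep :: "'g \<Rightarrow> 'h \<Rightarrow> 'h" where
  "adjoint_rep s y = (SOME z. z \<in> carrier H \<and> (\<forall>x\<in>carrier H. cinner H (\<pi> (- s) x) y = cinner H x z))"

lemma adjoint_rep_closed [simp]: "y \<in> carrier H \<Longrightarrow> adjoint_rep s y \<in> carrier H"
  and cinner_adjoint_rep: "\<lbrakk>x \<in> carrier H; y \<in> carrier H\<rbrakk> \<Longrightarrow>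
    cinner H x (adjoint_rep s y) = cinner H (\<pi> (- s) x) y"
  using someI_ex[OF adjoint_exists[of y "- s", unfolded Bex_def]] by (auto simp: adjoint_rep_def)

lemma cinner_adjoint_rep_left: "\<lbrakk>x \<in> carrier H; y \<in> carrier H\<rbrakk> \<Longrightarrow>
    cinner H (adjoint_rep s y) x = cnj (cinner H (\<pi> (- s) x) y)"
  using cinner_commute[of "adjoint_rep s y" x] by (simp add: cinner_adjoint_rep)

text \<open>The algebraic laws follow by testing against all vectors. For the bound, the squared
  norm of \<open>z = adjoint_rep s x\<close> is \<open>cinner H (\<pi> (- s) z) x\<close>, at most
  \<open>c * hnorm H z * hnorm H x\<close>, and one factor cancels.\<close>

lemma uniformly_bounded_rep_adjoint: "uniformly_bounded_rep H adjoint_rep c"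
proof
  show "adjoint_rep s (x \<oplus>\<^bsub>H\<^esub> y) = adjoint_rep s x \<oplus>\<^bsub>H\<^esub> adjoint_rep s y"
    if "x \<in> carrier H" "y \<in> carrier H" for s x y
    by (rule eq_if_cinner_eq) (use that in \<open>simp_all add: cinner_adjoint_rep cinner_add_right\<close>)
  show "adjoint_rep s (a \<odot>\<^bsub>H\<^esub> x) = a \<odot>\<^bsub>H\<^esub> adjoint_rep s x" if "x \<in> carrier H" for s a x
    by (rule eq_if_cinner_eq) (use that in \<open>simp_all add: cinner_adjoint_rep cinner_smult_right\<close>)
  show "adjoint_rep (s + t) x = adjoint_rep s (adjoint_rep t x)" if "x \<in> carrier H" for s t x
    by (rule eq_if_cinner_eq)
      (use that in \<open>simp_all add: cinner_adjoint_rep group_add_class.minus_add flip: rep_mult\<close>)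
  show "adjoint_rep 0 x = x" if "x \<in> carrier H" for x
    by (rule eq_if_cinner_eq) (use that in \<open>simp_all add: cinner_adjoint_rep rep_one\<close>)
  show "hnorm H (adjoint_rep s x) \<le> c * hnorm H x" if x: "x \<in> carrier H" for s x
  proof (cases "hnorm H (adjoint_rep s x) = 0")
    case True
    then show ?thesis using x c_ge_1 by simp
  next
    case False
    let ?z = "adjoint_rep s x"
    have z: "?z \<in> carrier H" using x by simp
    have pos: "hnorm H ?z > 0" using False hnorm_nonneg[OF z] by linarith
    have "of_real ((hnorm H ?z)\<^sup>2) = cinner H (\<pi> (- s) ?z) x"
      using cinner_self[OF z] cinner_adjoint_rep[OF z x] by simp
    then have "(hnorm H ?z)\<^sup>2 = cmod (cinner H (\<pi> (- s) ?z) x)"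
      by (metis abs_of_nonneg norm_of_real zero_le_power2)
    also have "\<dots> \<le> hnorm H (\<pi> (- s) ?z) * hnorm H x"
      by (rule Cauchy_Schwarz) (use x z in auto)
    also have "\<dots> \<le> c * hnorm H ?z * hnorm H x"
      by (intro mult_right_mono rep_bound) (use x z in auto)
    finally show ?thesis
      using pos by (simp add: power2_eq_square)
  qed
qed (simp_all add: c_ge_1)

text \<open>Coefficients of the adjoint are conjugates of those of \<open>\<pi>\<close> at the
  inverse with the vectors exchanged, so strong continuity of \<open>\<pi>\<close> and continuity of
  inversion give weak continuity, which uniform convexity then upgrades.\<close>

lemma bounded_representation_adjoint:
  assumes cont: "\<And>x. x \<in> carrier H \<Longrightarrow> continuous_map euclidean (htopology H) (\<lambda>s. \<pi> s x)"
  shows "bounded_representation c H adjoint_rep"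
proof -
  interpret adj: uniformly_bounded_rep H adjoint_rep c
    by (rule uniformly_bounded_rep_adjoint)
  have "((\<lambda>s. cinner H (adjoint_rep s x) y) \<longlongrightarrow> cinner H (adjoint_rep s x) y) (nhds s)"
    if "x \<in> carrier H" "y \<in> carrier H" for x y s
  proof -
    have "((\<lambda>t. hnorm H (\<pi> t y \<ominus>\<^bsub>H\<^esub> \<pi> (- s) y)) \<longlongrightarrow> 0) (nhds (- s))"
      using cont[of y] that by (simp add: continuous_map_htopology)
    moreover have "filterlim uminus (nhds (- s)) (nhds s)"
      by (rule tendsto_minus[OF filterlim_ident])
    ultimately have "((\<lambda>t. hnorm H (\<pi> (- t) y \<ominus>\<^bsub>H\<^esub> \<pi> (- s) y)) \<longlongrightarrow> 0) (nhds s)"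
      by (rule filterlim_compose)
    then have "((\<lambda>t. cinner H (\<pi> (- t) y) x) \<longlongrightarrow> cinner H (\<pi> (- s) y) x) (nhds s)"
      by (rule tendsto_cinner_left[rotated -1]) (use that in auto)
    then show ?thesis
      using that by (simp add: cinner_adjoint_rep_left tendsto_cnj)
  qed
  then show ?thesis
    by (intro adj.bounded_representationI adj.strongly_continuous_if_weakly_continuous)
qed

end

subsection \<open>Closure properties of the coefficient spaces\<close>

lemma B_spaceE:
  fixes \<phi> :: "'g::topological_group_add \<Rightarrow> complex"
  assumes "\<phi> \<in> B_space c" "c \<ge> 1"
  obtains H :: "('g \<Rightarrow> complex \<times> complex) inner_module" and \<pi> \<xi> \<eta>
  where "uniformly_bounded_rep H \<pi> c"
    "\<And>x. x \<in> carrier H \<Longrightarrow> continuous_map euclidean (htopology H) (\<lambda>s. \<pi> s x)"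
    "\<xi> \<in> carrier H" "\<eta> \<in> carrier H" "\<phi> = (\<lambda>s. cinner H (\<pi> s \<xi>) \<eta>)"
proof -
  obtain H :: "('g \<Rightarrow> complex \<times> complex) inner_module" and \<pi> \<xi> \<eta>
    where *: "complex_hilbert_space H" "bounded_representation c H \<pi>"
      "\<xi> \<in> carrier H" "\<eta> \<in> carrier H" "\<phi> = (\<lambda>s. cinner H (\<pi> s \<xi>) \<eta>)"
    using assms(1) unfolding B_space_def by blast
  show thesis
  proof (rule that)
    show "uniformly_bounded_rep H \<pi> c"
      by (rule uniformly_bounded_rep_if_bounded_representation[OF *(1,2) assms(2)])
    show "\<And>x. x \<in> carrier H \<Longrightarrow> continuous_map euclidean (htopology H) (\<lambda>s. \<pi> s x)"
      using *(2) by (simp add: bounded_representation_def)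
  qed (use * in auto)
qed

lemma (in uniformly_bounded_rep) coefficient_in_B_spaceI:
  assumes "\<And>x. x \<in> carrier H \<Longrightarrow> continuous_map euclidean (htopology H) (\<lambda>s. \<pi> s x)"
    and "\<xi> \<in> carrier H" "\<eta> \<in> carrier H"
  shows "(\<lambda>s. cinner H (\<pi> s \<xi>) \<eta>) \<in> B_space c"
  using complex_hilbert_space_axioms bounded_representationI[OF assms(1)] assms(2,3)
  by (rule coefficient_in_B_space)

context
  fixes c :: real
  assumes c: "c \<ge> 1"
begin

lemma B_space_const: "(\<lambda>s. a) \<in> (B_space c :: ('g::topological_group_add \<Rightarrow> complex) set)"
proof -
  interpret complex_hilbert_space complex_line
    by (rule complex_hilbert_space_complex_line)
  interpret uniformly_bounded_rep complex_line "\<lambda>s::'g. \<lambda>x. x" c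
    by unfold_locales (use c in \<open>auto intro: mult_right_mono[of 1 c, simplified]\<close>)
  have "(\<lambda>s::'g. cinner complex_line a 1) \<in> B_space c"
    using metric.topspace_mtopology by (intro coefficient_in_B_spaceI) auto
  then show ?thesis by simp
qed

lemma B_space_scale:
  assumes "\<phi> \<in> B_space c"
  shows "(\<lambda>s. a * \<phi> s) \<in> B_space c"
  using assms c
proof (rule B_spaceE)
  fix H \<pi> \<xi> \<eta>
  assume "uniformly_bounded_rep H \<pi> c"
    and cont: "\<And>x. x \<in> carrier H \<Longrightarrow> continuous_map euclidean (htopology H) (\<lambda>s. \<pi> s x)"
    and \<xi>\<eta>: "\<xi> \<in> carrier H" "\<eta> \<in> carrier H" and \<phi>: "\<phi> = (\<lambda>s. cinner H (\<pi> s \<xi>) \<eta>)"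
  then interpret uniformly_bounded_rep H \<pi> c by simp
  show "(\<lambda>s. a * \<phi> s) \<in> B_space c"
    using coefficient_in_B_spaceI[OF cont, of "a \<odot>\<^bsub>H\<^esub> \<xi>" \<eta>] \<xi>\<eta>
    by (simp add: \<phi> rep_smult cinner_smult_left)
qed

lemma B_space_right_translate:
  assumes "\<phi> \<in> B_space c"
  shows "(\<lambda>t. \<phi> (t + s)) \<in> B_space c"
  using assms c
proof (rule B_spaceE)
  fix H \<pi> \<xi> \<eta>
  assume "uniformly_bounded_rep H \<pi> c"
    and cont: "\<And>x. x \<in> carrier H \<Longrightarrow> continuous_map euclidean (htopology H) (\<lambda>s. \<pi> s x)"
    and \<xi>\<eta>: "\<xi> \<in> carrier H" "\<eta> \<in> carrier H" and \<phi>: "\<phi> = (\<lambda>s. cinner H (\<pi> s \<xi>) \<eta>)"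
  then interpret uniformly_bounded_rep H \<pi> c by simp
  show "(\<lambda>t. \<phi> (t + s)) \<in> B_space c"
    using coefficient_in_B_spaceI[OF cont, of "\<pi> s \<xi>" \<eta>] \<xi>\<eta> by (simp add: \<phi> rep_mult)
qed

lemma B_space_cnj:
  assumes "\<phi> \<in> B_space c"
  shows "(\<lambda>s. cnj (\<phi> s)) \<in> B_space c"
  using assms c
proof (rule B_spaceE)
  fix H \<pi> \<xi> \<eta>
  assume "uniformly_bounded_rep H \<pi> c"
    and cont: "\<And>x. x \<in> carrier H \<Longrightarrow> continuous_map euclidean (htopology H) (\<lambda>s. \<pi> s x)"
    and \<xi>\<eta>: "\<xi> \<in> carrier H" "\<eta> \<in> carrier H" and \<phi>: "\<phi> = (\<lambda>s. cinner H (\<pi> s \<xi>) \<eta>)"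
  then interpret uniformly_bounded_rep H \<pi> c by simp
  interpret conj: uniformly_bounded_rep "conj_space H" \<pi> c
    by (rule uniformly_bounded_rep_conj_space)
  show "(\<lambda>s. cnj (\<phi> s)) \<in> B_space c"
    using conj.coefficient_in_B_spaceI[of \<xi> \<eta>] cont \<xi>\<eta>
      cinner_commute[OF \<xi>\<eta>(2) rep_closed[OF \<xi>\<eta>(1)]]
    by (simp add: \<phi>)
qed

text \<open>\<open>\<phi> (- s)\<close> is the conjugate of the adjoint's coefficient at
  \<open>\<eta>\<close> and \<open>\<xi>\<close>, which is in \<open>B_space c\<close> because the
  adjoint is strongly continuous.\<close>

lemma B_space_inversion:
  assumes "\<phi> \<in> B_space c"
  shows "(\<lambda>s. \<phi> (- s)) \<in> B_space c"
  using assms c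
proof (rule B_spaceE)
  fix H \<pi> \<xi> \<eta>
  assume "uniformly_bounded_rep H \<pi> c"
    and cont: "\<And>x. x \<in> carrier H \<Longrightarrow> continuous_map euclidean (htopology H) (\<lambda>s. \<pi> s x)"
    and \<xi>\<eta>: "\<xi> \<in> carrier H" "\<eta> \<in> carrier H" and \<phi>: "\<phi> = (\<lambda>s. cinner H (\<pi> s \<xi>) \<eta>)"
  then interpret uniformly_bounded_rep H \<pi> c by simp
  have "(\<lambda>s. cinner H (adjoint_rep s \<eta>) \<xi>) \<in> B_space c"
    using complex_hilbert_space_axioms bounded_representation_adjoint[OF cont] \<xi>\<eta>(2,1)
    by (rule coefficient_in_B_space)
  from B_space_cnj[OF this] show "(\<lambda>s. \<phi> (- s)) \<in> B_space c"
    using \<xi>\<eta> by (simp add: \<phi> cinner_adjoint_rep_left)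
qed

text \<open>Inverting, translating on the right by \<open>- s\<close> and inverting again translates
  on the left by \<open>s\<close>.\<close>

lemma B_space_left_translate:
  assumes "\<phi> \<in> B_space c"
  shows "(\<lambda>t. \<phi> (s + t)) \<in> B_space c"
  using B_space_inversion[OF B_space_right_translate[OF B_space_inversion[OF assms], of "- s"]]
  by (simp add: minus_add)

text \<open>The sum is a coefficient of the diagonal representation \<open>\<tau>\<close> on the
  orthogonal sum. That space lives in a product type, from which
  \<open>coefficient_in_B_spaceI\<close> leads back to \<open>B_space c\<close>.\<close>

lemma B_space_add:
  fixes \<phi> \<psi> :: "'g::topological_group_add \<Rightarrow> complex"
  assumes \<phi>: "\<phi> \<in> B_space c" and \<psi>: "\<psi> \<in> B_space c"
  shows "(\<lambda>s. \<phi> s + \<psi> s) \<in> B_space c"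
proof -
  obtain H :: "('g \<Rightarrow> complex \<times> complex) inner_module" and \<pi> \<xi> \<eta>
    where H: "uniformly_bounded_rep H \<pi> c"
      and contH: "\<And>x. x \<in> carrier H \<Longrightarrow> continuous_map euclidean (htopology H) (\<lambda>s. \<pi> s x)"
      and \<xi>\<eta>: "\<xi> \<in> carrier H" "\<eta> \<in> carrier H" and \<phi>: "\<phi> = (\<lambda>s. cinner H (\<pi> s \<xi>) \<eta>)"
    using \<phi> c by (rule B_spaceE) blast
  obtain K :: "('g \<Rightarrow> complex \<times> complex) inner_module" and \<rho> \<xi>' \<eta>'
    where K: "uniformly_bounded_rep K \<rho> c"
      and contK: "\<And>x. x \<in> carrier K \<Longrightarrow> continuous_map euclidean (htopology K) (\<lambda>s. \<rho> s x)"
      and \<xi>\<eta>': "\<xi>' \<in> carrier K" "\<eta>' \<in> carrier K" and \<psi>: "\<psi> = (\<lambda>s. cinner K (\<rho> s \<xi>') \<eta>')"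
    using \<psi> c by (rule B_spaceE) blast
  interpret H: uniformly_bounded_rep H \<pi> c by (rule H)
  interpret K: uniformly_bounded_rep K \<rho> c by (rule K)
  interpret two_hilbert_spaces H K ..
  let ?S = "orthogonal_sum H K"
  define \<tau> where "\<tau> s u = (\<pi> s (fst u), \<rho> s (snd u))" for s u
  interpret S: complex_hilbert_space ?S
    by (rule complex_hilbert_space_orthogonal_sum)
  have \<tau>: "\<tau> s u \<in> carrier ?S" if "u \<in> carrier ?S" for s u
    using that by (auto simp: \<tau>_def)
  interpret S: uniformly_bounded_rep ?S \<tau> c
  proof
    show "hnorm ?S (\<tau> s u) \<le> c * hnorm ?S u" if u: "u \<in> carrier ?S" for s u
    proof -
      have "(hnorm H (\<pi> s (fst u)))\<^sup>2 \<le> (c * hnorm H (fst u))\<^sup>2"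
        "(hnorm K (\<rho> s (snd u)))\<^sup>2 \<le> (c * hnorm K (snd u))\<^sup>2"
        using u by (auto intro!: power_mono H.rep_bound K.rep_bound)
      then have "hnorm ?S (\<tau> s u) \<le> sqrt (c\<^sup>2 * ((hnorm H (fst u))\<^sup>2 + (hnorm K (snd u))\<^sup>2))"
        unfolding hnorm_orthogonal_sum[OF \<tau>[OF u]]
        by (intro real_sqrt_le_mono) (simp add: \<tau>_def power_mult_distrib distrib_left)
      also have "\<dots> = c * hnorm ?S u"
        unfolding hnorm_orthogonal_sum[OF u] using c by (simp add: real_sqrt_mult)
      finally show ?thesis .
    qed
  qed (use c in \<open>auto simp: \<tau>_def H.rep_add K.rep_add H.rep_smult K.rep_smult H.rep_mult K.rep_mult
      H.rep_one K.rep_one\<close>)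
  have "continuous_map euclidean (htopology ?S) (\<lambda>s. \<tau> s u)" if u: "u \<in> carrier ?S" for u
  proof -
    have uHK: "fst u \<in> carrier H" "snd u \<in> carrier K" using u by auto
    have "((\<lambda>t. hnorm H (fst (\<tau> t u) \<ominus>\<^bsub>H\<^esub> fst (\<tau> s u))) \<longlongrightarrow> 0) (nhds s)"
      "((\<lambda>t. hnorm K (snd (\<tau> t u) \<ominus>\<^bsub>K\<^esub> snd (\<tau> s u))) \<longlongrightarrow> 0) (nhds s)" for s
      using contH[OF uHK(1)] contK[OF uHK(2)] uHK
      by (simp_all add: \<tau>_def H.continuous_map_htopology K.continuous_map_htopology)
    then show ?thesis
      unfolding sum.continuous_map_htopology[OF \<tau>[OF u]]
      by (intro allI tendsto_hnorm_orthogonal_sum \<tau> u)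
  qed
  from S.coefficient_in_B_spaceI[OF this, of "(\<xi>, \<xi>')" "(\<eta>, \<eta>')"] show ?thesis
    using \<xi>\<eta> \<xi>\<eta>' by (simp add: \<phi> \<psi> \<tau>_def)
qed

end


subsection \<open>Averages of translates\<close>

text \<open>Averages are operators on functions, so that one average can be applied to several
  functions and composed with another. Only dyadic weights arise.\<close>

inductive_set averages :: "('g \<Rightarrow> 'g) set \<Rightarrow> (('g \<Rightarrow> complex) \<Rightarrow> 'g \<Rightarrow> complex) set"
  for F :: "('g \<Rightarrow> 'g) set" where
  translate: "f \<in> F \<Longrightarrow> (\<lambda>\<phi> t. \<phi> (f t)) \<in> averages F"
| midpoint: "\<lbrakk>A \<in> averages F; B \<in> averages F\<rbrakk> \<Longrightarrow> (\<lambda>\<phi> t. (A \<phi> t + B \<phi> t) / 2) \<in> averages F"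

lemma averages_add:
  assumes "A \<in> averages F"
  shows "A (\<lambda>t. \<phi> t + \<psi> t) t = A \<phi> t + A \<psi> t"
  using assms by (induction arbitrary: t) (simp_all add: field_simps)

lemma averages_scale:
  assumes "A \<in> averages F"
  shows "A (\<lambda>t. a * \<phi> t) t = a * A \<phi> t"
  using assms by (induction arbitrary: t) (simp_all add: field_simps)

text \<open>Discs are convex; once a function is uniformly close to a constant, further averaging
  cannot spoil this.\<close>

lemma averages_near:
  assumes "A \<in> averages F" and near: "\<And>t. cmod (\<phi> t - a) \<le> e"
  shows "cmod (A \<phi> t - a) \<le> e"
  using assms(1)
proof (induction arbitrary: t)
  case (midpoint A B)
  have "(A \<phi> t + B \<phi> t) / 2 - a = ((A \<phi> t - a) + (B \<phi> t - a)) / 2"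
    by (simp add: field_simps)
  then have "cmod ((A \<phi> t + B \<phi> t) / 2 - a) \<le> (cmod (A \<phi> t - a) + cmod (B \<phi> t - a)) / 2"
    using norm_triangle_ineq[of "A \<phi> t - a" "B \<phi> t - a"] by (simp only: norm_divide) simp
  then show ?case using midpoint.IH[of t] by simp
qed (rule near)

lemma averages_nonneg:
  assumes "A \<in> averages F" "\<And>t. \<phi> t \<in> \<real>\<^sub>\<ge>\<^sub>0"
  shows "A \<phi> t \<in> \<real>\<^sub>\<ge>\<^sub>0"
  using assms by (induction arbitrary: t) (auto intro!: nonneg_Reals_divide_I nonneg_Reals_add_I)

lemma averages_compose:
  assumes F: "\<forall>f\<in>F. \<forall>g\<in>F. f \<circ> g \<in> F"
    and A: "A \<in> averages F" and B: "B \<in> averages F"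
  shows "(\<lambda>\<phi>. A (B \<phi>)) \<in> averages F"
  using A
proof induction
  case (translate f)
  show ?case using B
  proof induction
    case (translate g)
    show ?case using averages.translate[OF F[rule_format, OF translate \<open>f \<in> F\<close>]] by simp
  qed (rule averages.midpoint)
qed (rule averages.midpoint)

text \<open>Induction on \<open>A\<close> and, inside it, on \<open>B\<close> reduces to single
  maps, which commute; the midpoint case of \<open>A\<close> uses linearity of
  \<open>B\<close>.\<close>

lemma averages_commute:
  assumes comm: "\<forall>f\<in>F. \<forall>g\<in>G. f \<circ> g = g \<circ> f"
    and A: "A \<in> averages F" and B: "B \<in> averages G"
  shows "A (B \<phi>) = B (A \<phi>)"
  using A
proof induction
  case (translate f)
  show ?case using B
  proof induction
    case (translate g)
    have "g (f t) = f (g t)" for t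
      using fun_cong[OF comm[rule_format, OF \<open>f \<in> F\<close> translate], of t] by simp
    then show ?case by simp
  qed (simp add: fun_eq_iff)
next
  case (midpoint A\<^sub>1 A\<^sub>2)
  have "B (\<lambda>t. (A\<^sub>1 \<phi> t + A\<^sub>2 \<phi> t) / 2) s = (B (A\<^sub>1 \<phi>) s + B (A\<^sub>2 \<phi>) s) / 2" for s
    using averages_scale[OF B, of "1/2" "\<lambda>t. A\<^sub>1 \<phi> t + A\<^sub>2 \<phi> t" s]
      averages_add[OF B, of "A\<^sub>1 \<phi>" "A\<^sub>2 \<phi>" s]
    by simp
  then show ?case by (simp add: midpoint.IH fun_eq_iff)
qed

text \<open>Membership of the constant \<open>a\<close> in the uniform closure of the averages. It
  is a relation because existence and uniqueness come only later.\<close>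

definition average_value :: "('g \<Rightarrow> 'g) set \<Rightarrow> ('g \<Rightarrow> complex) \<Rightarrow> complex \<Rightarrow> bool" where
  "average_value F \<phi> a \<longleftrightarrow> (\<forall>e>0. \<exists>A\<in>averages F. \<forall>t. cmod (A \<phi> t - a) \<le> e)"

text \<open>An average over \<open>G\<close> that brings \<open>\<phi>\<close> near \<open>a\<close>
  commutes with \<open>A\<close>, and \<open>A\<close> preserves closeness to a constant.\<close>

lemma average_value_average:
  assumes comm: "\<forall>f\<in>F. \<forall>g\<in>G. f \<circ> g = g \<circ> f"
    and A: "A \<in> averages F" and \<phi>: "average_value G \<phi> a"
  shows "average_value G (A \<phi>) a"
  unfolding average_value_def
proof (intro allI impI)
  fix e :: real assume "e > 0"
  then obtain B where B: "B \<in> averages G" "\<And>t. cmod (B \<phi> t - a) \<le> e"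
    using \<phi> by (auto simp: average_value_def)
  then show "\<exists>B\<in>averages G. \<forall>t. cmod (B (A \<phi>) t - a) \<le> e"
    using averages_near[where \<phi> = "B \<phi>", OF A B(2)] averages_commute[OF comm A B(1), of \<phi>]
    by (intro bexI[of _ B]) auto
qed

text \<open>\<open>B (A \<phi>)\<close> is close to \<open>a\<close> because \<open>B\<close>
  preserves closeness, and close to \<open>b\<close> because \<open>A \<phi>\<close> still has the
  value \<open>b\<close>. Two values on one side are thus identified through a value on the
  other.\<close>

lemma average_value_unique:
  assumes comm: "\<forall>f\<in>F. \<forall>g\<in>G. f \<circ> g = g \<circ> f"
    and F: "average_value F \<phi> a" and G: "average_value G \<phi> b"
  shows "a = b"
proof -
  have "cmod (a - b) \<le> 0 + e" if e: "e > 0" for e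
  proof -
    obtain A where A: "A \<in> averages F" "\<And>t. cmod (A \<phi> t - a) \<le> e / 2"
      using F e unfolding average_value_def by (meson half_gt_zero)
    obtain B where B: "B \<in> averages G" "\<And>t. cmod (B (A \<phi>) t - b) \<le> e / 2"
      using average_value_average[OF comm A(1) G] e unfolding average_value_def
      by (meson half_gt_zero)
    have "cmod (B (A \<phi>) t - a) \<le> e / 2" for t
      by (rule averages_near[OF B(1) A(2)])
    \<comment> \<open>\<open>undefined\<close> is just some group element; the estimates hold at
      every point.\<close>
    then show ?thesis
      using B(2) norm_diff_triangle_le[of a "B (A \<phi>) undefined" "e / 2" b "e / 2"]
      by (simp add: norm_minus_commute)
  qed
  then have "cmod (a - b) \<le> 0" by (rule field_le_epsilon)
  then show ?thesis by simp
qed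

section \<open>Left and right translations, exchanged by inversion\<close>

abbreviation left_translations :: "('g::group_add \<Rightarrow> 'g) set" where
  "left_translations \<equiv> range (\<lambda>s t. s + t)"

abbreviation right_translations :: "('g::group_add \<Rightarrow> 'g) set" where
  "right_translations \<equiv> range (\<lambda>s t. t + s)"

lemma translations_commute:
  "\<forall>f\<in>left_translations. \<forall>g\<in>right_translations. f \<circ> g = g \<circ> f"
  by (auto simp: add.assoc)

lemma left_translations_compose:
  "\<forall>f\<in>left_translations. \<forall>g\<in>left_translations. f \<circ> g \<in> left_translations"
  by (auto simp: image_iff fun_eq_iff) (metis add.assoc)

lemma right_translations_compose:
  "\<forall>f\<in>right_translations. \<forall>g\<in>right_translations. f \<circ> g \<in> right_translations"
  by (auto simp: image_iff fun_eq_iff) (metis add.assoc)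

text \<open>Conjugation by inversion turns \<open>t + s\<close> into \<open>- s + t\<close>. One
  left average serves all functions.\<close>

lemma averages_inversion:
  assumes "A \<in> averages right_translations"
  shows "\<exists>B\<in>averages left_translations. \<forall>\<phi> t. B \<phi> t = A (\<lambda>t. \<phi> (- t)) (- t)"
  using assms
proof induction
  case (translate f)
  then obtain s where "f = (\<lambda>t. t + s)" by auto
  then show ?case
    by (intro bexI[OF _ averages.translate[of "\<lambda>t. - s + t"]]) (auto simp: minus_add)
next
  case (midpoint A A')
  then obtain B B' where "B \<in> averages left_translations" "\<And>\<phi> t. B \<phi> t = A (\<lambda>t. \<phi> (- t)) (- t)"
    "B' \<in> averages left_translations" "\<And>\<phi> t. B' \<phi> t = A' (\<lambda>t. \<phi> (- t)) (- t)" by blast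
  then show ?case
    by (intro bexI[OF _ averages.midpoint[of B _ B']]) auto
qed

lemma average_value_inversion:
  assumes "average_value right_translations (\<lambda>t. \<phi> (- t)) a"
  shows "average_value left_translations \<phi> a"
  unfolding average_value_def
proof (intro allI impI)
  fix e :: real assume "e > 0"
  then obtain A where "A \<in> averages right_translations" "\<And>t. cmod (A (\<lambda>t. \<phi> (- t)) t - a) \<le> e"
    using assms by (auto simp: average_value_def)
  then show "\<exists>A\<in>averages left_translations. \<forall>t. cmod (A \<phi> t - a) \<le> e"
    using averages_inversion by metis
qed


subsection \<open>The invariant mean\<close>

text \<open>Right translation of a coefficient moves \<open>\<xi>\<close> along its orbit, so right
  averages are coefficients of averaged orbit vectors. A fixed vector approximated by these gives a
  constant coefficient.\<close>

lemma right_average_value_exists: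
  fixes \<phi> :: "'g::topological_group_add \<Rightarrow> complex"
  assumes "\<phi> \<in> B_space c" "c \<ge> 1"
  shows "\<exists>a. average_value right_translations \<phi> a"
  using assms
proof (rule B_spaceE)
  fix H :: "('g \<Rightarrow> complex \<times> complex) inner_module" and \<pi> \<xi> \<eta>
  assume "uniformly_bounded_rep H \<pi> c"
    and \<xi>: "\<xi> \<in> carrier H" and \<eta>: "\<eta> \<in> carrier H" and \<phi>: "\<phi> = (\<lambda>s. cinner H (\<pi> s \<xi>) \<eta>)"
  then interpret uniformly_bounded_rep H \<pi> c by simp
  \<comment> \<open>\<open>S\<close> stands in for the convex hull of the orbit of
    \<open>\<xi>\<close>; its members are the vectors whose coefficient against
    \<open>\<eta>\<close> is an average of \<open>\<phi>\<close>.\<close>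
  define S where "S = {v \<in> carrier H. \<exists>A\<in>averages right_translations.
    \<forall>t. A \<phi> t = cinner H (\<pi> t v) \<eta>}"
  \<comment> \<open>Translation by 0 makes \<open>\<phi>\<close> one of its own averages, so that
    \<open>S\<close> is nonempty.\<close>
  have "(\<lambda>\<phi> t. \<phi> (t + 0)) \<in> averages (right_translations :: ('g \<Rightarrow> 'g) set)"
    by (rule averages.translate[OF rangeI])
  then have "\<xi> \<in> S"
    using \<xi> by (auto simp: S_def \<phi> intro!: bexI[of _ "\<lambda>\<phi> t. \<phi> (t + 0)"])
  moreover have "mid v w \<in> S" if v: "v \<in> S" and w: "w \<in> S" for v w
  proof -
    obtain A B where "A \<in> averages right_translations" "\<And>t. A \<phi> t = cinner H (\<pi> t v) \<eta>"
      "B \<in> averages right_translations" "\<And>t. B \<phi> t = cinner H (\<pi> t w) \<eta>"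
      using v w by (auto simp: S_def)
    then show ?thesis
      using v w \<eta> unfolding S_def
      by (auto intro!: bexI[OF _ averages.midpoint[of A _ B]] simp: rep_mid cinner_mid_left)
  qed
  moreover have "\<pi> s v \<in> S" if v: "v \<in> S" for s v
  proof -
    obtain A where A: "A \<in> averages right_translations" "\<And>t. A \<phi> t = cinner H (\<pi> t v) \<eta>"
      using v by (auto simp: S_def)
    have "(\<lambda>\<phi> t. A \<phi> (t + s)) \<in> averages right_translations"
      by (rule averages_compose[OF right_translations_compose averages.translate[OF rangeI] A(1)])
    then show ?thesis
      using v A(2) unfolding S_def
      by (auto intro!: bexI[of _ "\<lambda>\<phi> t. A \<phi> (t + s)"] simp: rep_mult)
  qed
  moreover have "S \<subseteq> carrier H" by (auto simp: S_def)
  ultimately obtain \<sigma> l where \<sigma>: "\<And>n. \<sigma> n \<in> S" and l: "l \<in> carrier H" "\<And>s. \<pi> s l = l"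
    and lim: "(\<lambda>n. hnorm H (\<sigma> n \<ominus>\<^bsub>H\<^esub> l)) \<longlonglongrightarrow> 0"
    using fixed_vector[of S] by (metis empty_iff)
  have "average_value right_translations \<phi> (cinner H l \<eta>)"
    unfolding average_value_def
  proof (intro allI impI)
    fix e :: real assume e: "e > 0"
    have "(\<lambda>n. c * hnorm H (\<sigma> n \<ominus>\<^bsub>H\<^esub> l) * hnorm H \<eta>) \<longlonglongrightarrow> 0"
      by (rule tendsto_eq_intros lim refl | simp)+
    then have "\<forall>\<^sub>F n in sequentially. c * hnorm H (\<sigma> n \<ominus>\<^bsub>H\<^esub> l) * hnorm H \<eta> < e"
      using e by (rule order_tendstoD(2))
    then obtain n where n: "c * hnorm H (\<sigma> n \<ominus>\<^bsub>H\<^esub> l) * hnorm H \<eta> < e"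
      by (meson eventually_happens sequentially_bot)
    obtain A where A: "A \<in> averages right_translations" "\<And>t. A \<phi> t = cinner H (\<pi> t (\<sigma> n)) \<eta>"
      using \<sigma>[of n] by (auto simp: S_def)
    have \<sigma>H: "\<sigma> n \<in> carrier H" using \<sigma>[of n] by (simp add: S_def)
    have "cmod (A \<phi> t - cinner H l \<eta>) \<le> e" for t
    proof -
      have "A \<phi> t - cinner H l \<eta> = cinner H (\<pi> t (\<sigma> n \<ominus>\<^bsub>H\<^esub> l)) \<eta>"
        using \<sigma>H l \<eta> by (simp add: A(2) rep_diff cinner_diff_left)
      also have "cmod \<dots> \<le> hnorm H (\<pi> t (\<sigma> n \<ominus>\<^bsub>H\<^esub> l)) * hnorm H \<eta>"
        by (rule Cauchy_Schwarz) (use \<sigma>H l \<eta> in auto)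
      also have "\<dots> \<le> c * hnorm H (\<sigma> n \<ominus>\<^bsub>H\<^esub> l) * hnorm H \<eta>"
        by (intro mult_right_mono rep_bound) (use \<sigma>H l \<eta> in auto)
      finally show ?thesis using n by simp
    qed
    then show "\<exists>A\<in>averages right_translations. \<forall>t. cmod (A \<phi> t - cinner H l \<eta>) \<le> e"
      using A(1) by blast
  qed
  then show ?thesis ..
qed

text \<open>Uniqueness of the right value depends on left averages as well and is established for
  functions in \<open>B_space c\<close>.\<close>

definition average_mean :: "('g::topological_group_add \<Rightarrow> complex) \<Rightarrow> complex" where
  "average_mean \<phi> = (THE a. average_value right_translations \<phi> a)"

section \<open>Existence, inversion invariance and uniqueness of the mean\<close>

context
  fixes c :: real
  assumes c: "c \<ge> 1"
begin

lemma left_average_value_exists: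
  assumes "\<phi> \<in> B_space c"
  shows "\<exists>a. average_value left_translations \<phi> a"
  using right_average_value_exists[OF B_space_inversion[OF c assms] c] average_value_inversion
  by blast

text \<open>A left value exists and every right value equals it, so the definite description denotes
  and its number is the value on both sides.\<close>

lemma average_value_average_mean:
  assumes "\<phi> \<in> B_space c"
  shows "average_value left_translations \<phi> (average_mean \<phi>)"
    and "average_value right_translations \<phi> (average_mean \<phi>)"
proof -
  obtain a where a: "average_value left_translations \<phi> a"
    using left_average_value_exists[OF assms] ..
  obtain b where b: "average_value right_translations \<phi> b"
    using right_average_value_exists[OF assms c] ..
  have "average_mean \<phi> = a" "a = b"
    using average_value_unique[OF translations_commute a] b
    by (auto simp: average_mean_def intro!: the_equality)
  with a b show "average_value left_translations \<phi> (average_mean \<phi>)"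
    "average_value right_translations \<phi> (average_mean \<phi>)" by simp_all
qed

lemma average_mean_eqI:
  assumes "\<phi> \<in> B_space c"
    and "average_value left_translations \<phi> a \<or> average_value right_translations \<phi> a"
  shows "average_mean \<phi> = a"
  using assms average_value_unique[OF translations_commute] average_value_average_mean by metis

lemma left_average_in_B_space:
  assumes "A \<in> averages left_translations" "\<phi> \<in> B_space c"
  shows "A \<phi> \<in> B_space c"
  using assms(1)
proof induction
  case (translate f)
  then show ?case using B_space_left_translate[OF c assms(2)] by auto
next
  case (midpoint A B)
  then show ?case
    using B_space_scale[OF c B_space_add[OF c], of "A \<phi>" "B \<phi>" "1/2"] by simp
qed

text \<open>One average must work for both functions. First \<open>A\<close> settles
  \<open>\<phi>\<close>, then \<open>B\<close> settles \<open>A \<psi>\<close> and keeps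
  \<open>A \<phi>\<close> close to its constant.\<close>

lemma average_mean_add:
  assumes \<phi>: "\<phi> \<in> B_space c" and \<psi>: "\<psi> \<in> B_space c"
  shows "average_mean (\<lambda>s. \<phi> s + \<psi> s) = average_mean \<phi> + average_mean \<psi>"
proof (rule average_mean_eqI[OF B_space_add[OF c \<phi> \<psi>] disjI1], unfold average_value_def,
    intro allI impI)
  fix e :: real assume e: "e > 0"
  let ?L = "averages left_translations :: (('a \<Rightarrow> complex) \<Rightarrow> 'a \<Rightarrow> complex) set"
  let ?a = "average_mean \<phi>" and ?b = "average_mean \<psi>"
  obtain A where A: "A \<in> ?L" "\<And>t. cmod (A \<phi> t - ?a) \<le> e / 2"
    using average_value_average_mean(1)[OF \<phi>] e unfolding average_value_def by (meson half_gt_zero)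
  \<comment> \<open>Left averaging leaves right values unchanged.\<close>
  have "average_mean (A \<psi>) = ?b"
    by (rule average_mean_eqI[OF left_average_in_B_space[OF A(1) \<psi>] disjI2])
      (rule average_value_average[OF translations_commute A(1) average_value_average_mean(2)[OF \<psi>]])
  then obtain B where B: "B \<in> ?L" "\<And>t. cmod (B (A \<psi>) t - ?b) \<le> e / 2"
    using average_value_average_mean(1)[OF left_average_in_B_space[OF A(1) \<psi>]] e
    unfolding average_value_def by (metis half_gt_zero)
  have "cmod (B (A (\<lambda>s. \<phi> s + \<psi> s)) t - (?a + ?b)) \<le> e" for t
  proof -
    have eq: "B (A (\<lambda>s. \<phi> s + \<psi> s)) t - (?a + ?b) = (B (A \<phi>) t - ?a) + (B (A \<psi>) t - ?b)"
      by (simp add: averages_add[OF A(1), abs_def] averages_add[OF B(1)])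
    show ?thesis
      unfolding eq
      using norm_triangle_mono[OF averages_near[where \<phi> = "A \<phi>", OF B(1) A(2)] B(2), of t t]
      by (simp only: field_sum_of_halves)
  qed
  then show "\<exists>A\<in>?L. \<forall>t. cmod (A (\<lambda>s. \<phi> s + \<psi> s) t - (?a + ?b)) \<le> e"
    using averages_compose[OF left_translations_compose B(1) A(1)]
    by (intro bexI[of _ "\<lambda>\<phi>. B (A \<phi>)"]) auto
qed

lemma average_mean_scale:
  assumes \<phi>: "\<phi> \<in> B_space c"
  shows "average_mean (\<lambda>s. a * \<phi> s) = a * average_mean \<phi>"
proof (rule average_mean_eqI[OF B_space_scale[OF c \<phi>] disjI1], unfold average_value_def,
    intro allI impI)
  fix e :: real assume e: "e > 0"
  \<comment> \<open>The added 1 covers the case \<open>a = 0\<close>.\<close>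
  then have "e / (cmod a + 1) > 0"
    by (intro divide_pos_pos add_nonneg_pos) auto
  then obtain A where A: "A \<in> averages left_translations"
    "\<And>t. cmod (A \<phi> t - average_mean \<phi>) \<le> e / (cmod a + 1)"
    using average_value_average_mean(1)[OF \<phi>] unfolding average_value_def by meson
  have "cmod (A (\<lambda>s. a * \<phi> s) t - a * average_mean \<phi>) \<le> e" for t
  proof -
    have "A (\<lambda>s. a * \<phi> s) t - a * average_mean \<phi> = a * (A \<phi> t - average_mean \<phi>)"
      by (simp add: averages_scale[OF A(1)] algebra_simps)
    also have "cmod \<dots> \<le> (cmod a + 1) * (e / (cmod a + 1))"
      unfolding norm_mult by (intro mult_mono A(2)) auto
    also have "\<dots> = e"
      using add_nonneg_pos[OF norm_ge_zero[of a] zero_less_one] by simp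
    finally show ?thesis .
  qed
  with A(1) show "\<exists>A\<in>averages left_translations. \<forall>t. cmod (A (\<lambda>s. a * \<phi> s) t - a * average_mean \<phi>) \<le> e"
    by blast
qed

text \<open>The mean is a limit of values of averages at the point 0, and the nonnegative reals are
  closed.\<close>

lemma average_mean_nonneg:
  assumes "\<phi> \<in> B_space c" "\<And>s. \<phi> s \<in> \<real>\<^sub>\<ge>\<^sub>0"
  shows "average_mean \<phi> \<in> \<real>\<^sub>\<ge>\<^sub>0"
proof -
  have "\<exists>z\<in>\<real>\<^sub>\<ge>\<^sub>0. dist z (average_mean \<phi>) < e" if e: "e > 0" for e
  proof -
    obtain A where A: "A \<in> averages left_translations" "\<And>t. cmod (A \<phi> t - average_mean \<phi>) \<le> e / 2"
      using average_value_average_mean(1)[OF assms(1)] e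
      unfolding average_value_def by (meson half_gt_zero)
    have "dist (A \<phi> 0) (average_mean \<phi>) < e"
      using A(2)[of 0] e unfolding dist_norm by linarith
    then show ?thesis
      using averages_nonneg[where \<phi> = \<phi>, OF A(1) assms(2)] by blast
  qed
  then show ?thesis
    using closed_approachable[OF closed_nonneg_Reals_complex] by blast
qed

lemma invariant_mean_average_mean: "invariant_mean c average_mean"
  unfolding invariant_mean_def is_mean_def
proof (intro conjI allI ballI impI)
  show "average_mean (\<lambda>s. 1) = 1"
    by (rule average_mean_eqI[OF B_space_const[OF c]])
      (auto simp: average_value_def intro!: bexI[OF _ averages.translate[OF rangeI[of _ 0]]])
  \<comment> \<open>A left translation is itself a left average, so it preserves the right
    value.\<close>
  show "average_mean (\<lambda>t. \<phi> (- s + t)) = average_mean \<phi>" if "\<phi> \<in> B_space c" for s \<phi>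
    using average_value_average[OF translations_commute averages.translate[OF rangeI[of _ "- s"]]
        average_value_average_mean(2)[OF that]]
    by (rule average_mean_eqI[OF B_space_left_translate[OF c that] disjI2])
qed (simp_all add: average_mean_add average_mean_scale average_mean_nonneg)

text \<open>A right value of the inverted function is a left value of \<open>\<phi>\<close>, and
  both sides determine the mean.\<close>

lemma average_mean_inversion:
  assumes "\<phi> \<in> B_space c"
  shows "average_mean (\<lambda>s. \<phi> (- s)) = average_mean \<phi>"
  using average_value_inversion[OF average_value_average_mean(2)[OF B_space_inversion[OF c assms]]]
  by (metis assms average_mean_eqI)

text \<open>Positivity gives the bound \<open>e\<close> for real-valued functions; the factor 2
  comes from adding real and imaginary parts.\<close>

lemma mean_bound:
  fixes \<psi> :: "'g::topological_group_add \<Rightarrow> complex"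
  assumes m: "is_mean c m" and \<psi>: "\<psi> \<in> B_space c" and le: "\<And>t. cmod (\<psi> t) \<le> e"
  shows "cmod (m \<psi>) \<le> 2 * e"
proof -
  note B = B_space_add[OF c] B_space_scale[OF c] B_space_cnj[OF c] B_space_const[OF c]
  have add: "m (\<lambda>s. \<phi> s + \<psi> s) = m \<phi> + m \<psi>" if "\<phi> \<in> B_space c" "\<psi> \<in> B_space c" for \<phi> \<psi>
    using m that by (simp add: is_mean_def)
  have scale: "m (\<lambda>s. a * \<phi> s) = a * m \<phi>" if "\<phi> \<in> B_space c" for \<phi> a
    using m that by (simp add: is_mean_def)
  have pos: "m \<phi> \<in> \<real>\<^sub>\<ge>\<^sub>0" if "\<phi> \<in> B_space c" "\<And>s. \<phi> s \<in> \<real>\<^sub>\<ge>\<^sub>0" for \<phi>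
    using m that by (simp add: is_mean_def)
  have const: "m (\<lambda>s. a) = a" for a
    using scale[OF B(4), of a 1] m by (simp add: is_mean_def)
  have real: "cmod (m \<rho>) \<le> e" if \<rho>: "\<rho> \<in> B_space c" and r: "\<And>t. \<rho> t = of_real (r t)" "\<And>t. \<bar>r t\<bar> \<le> e"
    for \<rho> :: "'g \<Rightarrow> complex" and r
  proof -
    have r_ge: "0 \<le> e + r t" "r t \<le> e" for t
      using r(2)[of t] by auto
    \<comment> \<open>Both \<open>e + \<rho>\<close> and \<open>e - \<rho>\<close> are nonnegative,
      which makes \<open>m \<rho>\<close> real and at most \<open>e\<close> in absolute
      value.\<close>
    have "m (\<lambda>t. of_real e + \<rho> t) \<in> \<real>\<^sub>\<ge>\<^sub>0"
      using r by (intro pos B \<rho>) (simp add: complex_nonneg_Reals_iff r_ge)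
    moreover have "m (\<lambda>t. of_real e + (-1) * \<rho> t) \<in> \<real>\<^sub>\<ge>\<^sub>0"
      using r by (intro pos B \<rho>) (simp add: complex_nonneg_Reals_iff r_ge)
    moreover have "m (\<lambda>t. of_real e + \<rho> t) = of_real e + m \<rho>"
      "m (\<lambda>t. of_real e + (-1) * \<rho> t) = of_real e + (-1) * m \<rho>"
      by (simp_all only: add scale const B \<rho>)
    ultimately have "Im (m \<rho>) = 0" "\<bar>Re (m \<rho>)\<bar> \<le> e"
      by (auto simp: complex_nonneg_Reals_iff abs_le_iff)
    then show ?thesis by (simp add: cmod_eq_Re)
  qed
  \<comment> \<open>Real and imaginary parts are built from \<open>\<psi>\<close> and
    \<open>cnj\<close> in the shape of the closure rules, so that membership and linearity of
    \<open>m\<close> apply.\<close>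
  let ?r = "\<lambda>t. (1/2) * (\<psi> t + cnj (\<psi> t))" and ?i = "\<lambda>t. (- \<i>/2) * (\<psi> t + (-1) * cnj (\<psi> t))"
  have ri: "?r \<in> B_space c" "?i \<in> B_space c"
    by (intro B \<psi>)+
  have "cmod (m ?r) \<le> e"
    by (rule real[OF ri(1), of "\<lambda>t. Re (\<psi> t)"])
      (use order_trans[OF abs_Re_le_cmod le] in \<open>auto simp: complex_add_cnj\<close>)
  moreover have "cmod (m ?i) \<le> e"
    by (rule real[OF ri(2), of "\<lambda>t. Im (\<psi> t)"])
      (use order_trans[OF abs_Im_le_cmod le] in \<open>auto simp: complex_eq_iff\<close>)
  moreover have "m \<psi> = m ?r + \<i> * m ?i"
  proof -
    have "\<psi> = (\<lambda>t. ?r t + \<i> * ?i t)"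
      by (auto simp: fun_eq_iff complex_eq_iff)
    then have "m \<psi> = m (\<lambda>t. ?r t + \<i> * ?i t)"
      by (rule arg_cong)
    also have "\<dots> = m ?r + m (\<lambda>t. \<i> * ?i t)"
      by (rule add[OF ri(1) B(2)[OF ri(2)]])
    also have "m (\<lambda>t. \<i> * ?i t) = \<i> * m ?i"
      by (rule scale[OF ri(2)])
    finally show ?thesis .
  qed
  ultimately show ?thesis
    using norm_triangle_ineq[of "m ?r" "\<i> * m ?i"] by (simp add: norm_mult)
qed

text \<open>Left averaging does not change \<open>m \<phi>\<close>, and some left average of
  \<open>\<phi>\<close> is uniformly close to the constant \<open>?a\<close>, so
  \<open>mean_bound\<close> puts \<open>m \<phi>\<close> close to \<open>?a\<close>.\<close>

lemma invariant_mean_eq_average_mean: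
  assumes m: "invariant_mean c m" and \<phi>: "\<phi> \<in> B_space c"
  shows "m \<phi> = average_mean \<phi>"
proof -
  let ?a = "average_mean \<phi>"
  have mean: "is_mean c m" and inv: "m (\<lambda>t. \<psi> (s + t)) = m \<psi>" if "\<psi> \<in> B_space c" for \<psi> s
    using m that unfolding invariant_mean_def by (auto dest: spec[of _ "- s"])
  note mean = mean[OF \<phi>]
  have add: "m (\<lambda>s. \<phi> s + \<psi> s) = m \<phi> + m \<psi>" if "\<phi> \<in> B_space c" "\<psi> \<in> B_space c" for \<phi> \<psi>
    using mean that by (simp add: is_mean_def)
  have scale: "m (\<lambda>s. a * \<phi> s) = a * m \<phi>" if "\<phi> \<in> B_space c" for \<phi> a
    using mean that by (simp add: is_mean_def)
  have const: "m (\<lambda>s. a) = a" for a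
    using scale[OF B_space_const[OF c], of a 1] mean by (simp add: is_mean_def)
  have avg: "m (A \<phi>) = m \<phi>" if "A \<in> averages left_translations" for A
    using that
  proof induction
    case (translate f)
    then show ?case using inv[OF \<phi>] by auto
  next
    case (midpoint A B)
    note AB = left_average_in_B_space[OF midpoint.hyps(1) \<phi>]
      left_average_in_B_space[OF midpoint.hyps(2) \<phi>]
    have "m (\<lambda>t. (1/2) * (A \<phi> t + B \<phi> t)) = (1/2) * (m (A \<phi>) + m (B \<phi>))"
      by (simp only: scale[OF B_space_add[OF c AB]] add[OF AB])
    then show ?case by (simp add: midpoint.IH)
  qed
  have "cmod (m \<phi> - ?a) \<le> 0 + e" if e: "e > 0" for e
  proof -
    \<comment> \<open>The tolerance \<open>e / 2\<close> offsets the factor 2 of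
      \<open>mean_bound\<close>.\<close>
    obtain A where A: "A \<in> averages left_translations" "\<And>t. cmod (A \<phi> t - ?a) \<le> e / 2"
      using average_value_average_mean(1)[OF \<phi>] e unfolding average_value_def by (meson half_gt_zero)
    note A\<phi> = left_average_in_B_space[OF A(1) \<phi>]
    have "m (\<lambda>t. A \<phi> t + - ?a) = m \<phi> - ?a"
      by (simp only: add[OF A\<phi> B_space_const[OF c]] avg[OF A(1)] const) simp
    moreover have "cmod (m (\<lambda>t. A \<phi> t + - ?a)) \<le> 2 * (e / 2)"
      by (rule mean_bound[OF mean B_space_add[OF c A\<phi> B_space_const[OF c]]]) (use A(2) in simp)
    ultimately show ?thesis by simp
  qed
  then have "cmod (m \<phi> - ?a) \<le> 0" by (rule field_le_epsilon)
  then show ?thesis by simp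
qed

end

text \<open>Functionals are total functions with arbitrary values off \<open>B_space c\<close>, so
  uniqueness is stated among extensional ones.\<close>

theorem corollary2p6:
  fixes c :: real
  assumes "locally compact (UNIV :: 'g::{topological_group_add, t2_space} set)"
    and "c \<ge> 1"
  shows "(\<exists>!m. m \<in> (B_space c :: ('g \<Rightarrow> complex) set) \<rightarrow>\<^sub>E UNIV \<and> invariant_mean c m) \<and>
    (\<forall>m :: ('g \<Rightarrow> complex) \<Rightarrow> complex. invariant_mean c m \<longrightarrow> inversion_invariant c m)"
proof (intro conjI allI impI)
  note c = \<open>c \<ge> 1\<close>
  let ?B = "B_space c :: ('g \<Rightarrow> complex) set"
  show "\<exists>!m. m \<in> ?B \<rightarrow>\<^sub>E UNIV \<and> invariant_mean c m"
  proof (rule ex1I)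
    \<comment> \<open>Restriction is harmless because every function at which the axioms evaluate
      the mean lies in \<open>B_space c\<close>.\<close>
    have "invariant_mean c (restrict average_mean ?B)"
      using invariant_mean_average_mean[OF c, where ?'a = 'g] B_space_const[OF c, of 1, where ?'g = 'g]
      unfolding invariant_mean_def is_mean_def
      by (simp add: B_space_add[OF c] B_space_scale[OF c] B_space_left_translate[OF c])
    then show "restrict average_mean ?B \<in> ?B \<rightarrow>\<^sub>E UNIV \<and> invariant_mean c (restrict average_mean ?B)"
      by simp
    show "m = restrict average_mean ?B" if "m \<in> ?B \<rightarrow>\<^sub>E UNIV \<and> invariant_mean c m" for m
      using that invariant_mean_eq_average_mean[OF c]
      by (intro PiE_ext[of _ ?B "\<lambda>_. UNIV"]) auto
  qed
  show "inversion_invariant c m" if "invariant_mean c m" for m :: "('g \<Rightarrow> complex) \<Rightarrow> complex"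
    unfolding inversion_invariant_def
    using invariant_mean_eq_average_mean[OF c that] B_space_inversion[OF c]
      average_mean_inversion[OF c] by metis
qed

end
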